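(* Let $a$ and $c$ be nonzero complex numbers such that $c(c-a)\in\mathbb{R}$ and $|c|\ge 2|c-a|$. Then for every integer $m\ge 1$ the polynomials $Q_k^m(z,\bar z)$, $0\le k\le m$, have $\dim \Pi_{m-1}^2=\binom{m+1}{2}$ real, simple common zeros.
   Context: Here $z=x+iy$, $\bar z=x-iy$ with real variables $x,y$, so that a polynomial in $z,\bar z$ with complex coefficients is also a polynomial in $x,y$. $\Pi_{n}^2$ is the space of real polynomials of total degree at most $n$ in two variables, so $\dim\Pi_{m-1}^2=\binom{m+1}{2}$. For complex numbers $a,c$ and $m\ge 1$, $A^{a,c}_{m,m+1}(z,\bar z)$ is the $m\times(m+1)$ matrix with rows indexed by $i=0,\dots,m-1$ and columns indexed by $j=0,\dots,m$ whose entries are: $z$ at positions $(i,i)$; $\bar z$ at positions $(i,i+1)$; at positions $(i,i+2)$ with $i+2\le m$ the entry is $\bar c$, except that it is $\bar a$ when $i=0$; at positions $(i,i-1)$ with $i\ge1$ the entry is $c$, except that it is $a$ when $i=m-1$; all other entries are $0$. (For $m=1$ the matrix is $[\,z\ \ \bar z\,]$, and for $m=2$ its rows are $(z,\bar z,\bar a)$ and $(a,z,\bar z)$.) For $0\le k\le m$, $Q_k^m(z,\bar z)$ is the determinant of the $m\times m$ matrix obtained from $A^{a,c}_{m,m+1}(z,\bar z)$ by deleting the column with index $m-k$ (columns indexed $0,\dots,m$). Its leading term is $z^{m-k}\bar z^k$. A common zero of $Q_0^m,\dots,Q_m^m$, viewed as polynomials in $(x,y)$, is real if it is a point $(x,y)\in\mathbb{R}^2$;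 the common zeros are counted as distinct points. A common zero is simple if at least one of the first-order partial derivatives of the vector $(Q_0^m,\dots,Q_m^m)$ is not the zero vector at that point. *)

theory Defs
  imports
    "HOL-Analysis.Analysis"
    "HOL-Computational_Algebra.Polynomial"
    "Jordan_Normal_Form.Determinant"
begin

text \<open>
  A polynomial in \<open>z\<close> and its conjugate is represented by the function of two independent complex
  arguments \<open>z\<close>, \<open>w\<close>, where \<open>w\<close> takes the place of the conjugate of \<open>z\<close>. The genuine polynomial
  function on the plane is recovered at \<open>w = cnj z\<close>; keeping \<open>w\<close> free gives the values at complex
  points \<open>(x, y)\<close>, where \<open>x + iy\<close> and \<open>x - iy\<close> need not be conjugate.
\<close>

definition A_mat :: "complex \<Rightarrow> complex \<Rightarrow> nat \<Rightarrow> complex \<Rightarrow> complex \<Rightarrow> complex mat" where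
  "A_mat a c m z w = Matrix.mat m (m + 1) (\<lambda>(i, j).
     if j = i then z
     else if j = i + 1 then w
     else if j = i + 2 then (if i = 0 then cnj a else cnj c)
     else if i = j + 1 then (if i = m - 1 then a else c)
     else 0)"

text \<open>\<open>insert_index l\<close> enumerates in increasing order all indices other than \<open>l\<close>.\<close>

definition delete_col :: "'a mat \<Rightarrow> nat \<Rightarrow> 'a mat" where
  "delete_col B l = Matrix.mat (dim_row B) (dim_col B - 1) (\<lambda>(i, j). B $$ (i, insert_index l j))"

definition Q_poly :: "complex \<Rightarrow> complex \<Rightarrow> nat \<Rightarrow> nat \<Rightarrow> complex \<Rightarrow> complex \<Rightarrow> complex" where
  "Q_poly a c m k z w = Determinant.det (delete_col (A_mat a c m z w) (m - k))"

definition Q_xy :: "complex \<Rightarrow> complex \<Rightarrow> nat \<Rightarrow> nat \<Rightarrow> complex \<Rightarrow> complex \<Rightarrow> complex" where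
  "Q_xy a c m k x y = Q_poly a c m k (x + \<i> * y) (x - \<i> * y)"

definition common_zeros :: "complex \<Rightarrow> complex \<Rightarrow> nat \<Rightarrow> (complex \<times> complex) set" where
  "common_zeros a c m = {(x, y). \<forall>k\<le>m. Q_xy a c m k x y = 0}"

definition real_point :: "complex \<times> complex \<Rightarrow> bool" where
  "real_point p \<longleftrightarrow> fst p \<in> \<real> \<and> snd p \<in> \<real>"

text \<open>
  The complex partial derivatives used here agree at real points with the real ones, as the
  functions involved are polynomials.
\<close>

definition simple_zero :: "complex \<Rightarrow> complex \<Rightarrow> nat \<Rightarrow> complex \<times> complex \<Rightarrow> bool" where
  "simple_zero a c m p \<longleftrightarrow> p \<in> common_zeros a c m \<and>
     ((\<exists>k\<le>m. deriv (\<lambda>x. Q_xy a c m k x (snd p)) (fst p) \<noteq> 0) \<or>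
      (\<exists>k\<le>m. deriv (\<lambda>y. Q_xy a c m k (fst p) y) (snd p) \<noteq> 0))"

text \<open>
  Real polynomials in two variables of total degree at most \<open>n\<close>, as polynomials in one variable
  with polynomial coefficients in the other.
\<close>

definition Pi2 :: "nat \<Rightarrow> real poly poly set" where
  "Pi2 n = {p. \<forall>i j. Polynomial.coeff (Polynomial.coeff p i) j \<noteq> 0 \<longrightarrow> i + j \<le> n}"

definition dim_Pi2 :: "nat \<Rightarrow> nat" where
  "dim_Pi2 n = vector_space.dim (\<lambda>(r::real) p. Polynomial.smult [:r:] p) (Pi2 n)"

end

theory Submission
  imports Defs
begin

text \<open>
  All \<open>Q_k\<close> vanish at \<open>(z, w)\<close> if some \<open>v \<noteq> 0\<close> satisfies \<open>v A = 0\<close>. In terms of the generating polynomial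
  \<open>v(t) = \<Sum> v\<^sub>i t\<^sup>i\<close> and with \<open>b = c - a\<close> this says, for \<open>m \<ge> 2\<close>, that the cubic \<open>c + z t + w t\<^sup>2 + cnj c t\<^sup>3\<close>
  divides a member \<open>\<alpha> (c + cnj b t\<^sup>3) + \<beta> t\<^bsup>m-1\<^esup> (b + cnj c t\<^sup>3)\<close> of a pencil. Since \<open>\<bar>b\<bar> < \<bar>c\<bar>\<close>, the quotient
  \<open>t\<^bsup>m-1\<^esup> (b + cnj c t\<^sup>3) / (c + cnj b t\<^sup>3)\<close> is, up to a unimodular factor, a finite Blaschke product of degree
  \<open>m + 2\<close>; it maps the unit circle to itself with strictly increasing phase. So triples of distinct
  points of the circle with the same image and product \<open>- c / cnj c\<close> give zeros with \<open>w = cnj z\<close>. Lifting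
  the three points to angles whose sum is exactly the argument of \<open>- c / cnj c\<close>, the intermediate value
  theorem yields one triple for each choice of phase gaps \<open>0 < d < e < m + 2\<close>.

  Conversely \<open>Q_k = z\<^bsup>m-k\<^esup> w\<^sup>k + lower terms\<close>, so a functional that annihilates the ideal of the \<open>Q_k\<close> is
  determined by its values on polynomials of degree less than \<open>m\<close>. This bounds the number of zeros
  by \<open>(m + 1) choose 2\<close>, and a zero at which all first derivatives vanish would provide one
  independent functional too many.
\<close>

section \<open>Leading terms of the minors\<close>

text \<open>Gaussian elimination: one equation is solved for an unknown \<open>a0\<close> with
  nonzero coefficient and substituted into the others; an equation whose coefficients are all zero
  is dropped.\<close>

lemma exists_nontrivial_relation:
  fixes M :: "'i \<Rightarrow> 'b \<Rightarrow> 'a::field"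
  assumes "finite B" "finite A" "card B < card A"
  shows "\<exists>\<gamma>. (\<exists>a\<in>A. \<gamma> a \<noteq> 0) \<and> (\<forall>b\<in>B. (\<Sum>a\<in>A. \<gamma> a * M a b) = 0)"
  using assms
proof (induction B arbitrary: A M rule: finite_induct)
  case empty
  then obtain a where "a \<in> A" by fastforce
  then show ?case by (auto intro!: exI[of _ "\<lambda>_. 1"])
next
  case (insert b B)
  show ?case
  proof (cases "\<forall>a\<in>A. M a b = 0")
    case True
    have "card B < card A" using insert by simp
    then obtain \<gamma> where "\<exists>a\<in>A. \<gamma> a \<noteq> 0" "\<forall>b\<in>B. (\<Sum>a\<in>A. \<gamma> a * M a b) = 0"
      using insert.IH[of A M] insert.prems by blast
    then show ?thesis using True by (intro exI[of _ \<gamma>]) auto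
  next
    case False
    then obtain a0 where a0: "a0 \<in> A" "M a0 b \<noteq> 0" by auto
    define A' where "A' = A - {a0}"
    define M' where "M' = (\<lambda>a x. M a x - M a b / M a0 b * M a0 x)"
    have "card B < card A'" "finite A'"
      using insert a0 by (auto simp: A'_def)
    then obtain \<gamma> where \<gamma>: "\<exists>a\<in>A'. \<gamma> a \<noteq> 0" "\<forall>b\<in>B. (\<Sum>a\<in>A'. \<gamma> a * M' a b) = 0"
      using insert.IH[of A' M'] by blast
    define s where "s = (\<Sum>a\<in>A'. \<gamma> a * M a b)"
    define \<delta> where "\<delta> = \<gamma>(a0 := - s / M a0 b)"
    have sum_\<delta>: "(\<Sum>a\<in>A. \<delta> a * M a x) = (\<Sum>a\<in>A'. \<gamma> a * M a x) - s / M a0 b * M a0 x" for x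
    proof -
      have "(\<Sum>a\<in>A. \<delta> a * M a x) = \<delta> a0 * M a0 x + (\<Sum>a\<in>A'. \<delta> a * M a x)"
        unfolding A'_def using insert.prems a0 by (intro sum.remove) auto
      also have "(\<Sum>a\<in>A'. \<delta> a * M a x) = (\<Sum>a\<in>A'. \<gamma> a * M a x)"
        by (intro sum.cong) (auto simp: \<delta>_def A'_def)
      finally show ?thesis by (simp add: \<delta>_def)
    qed
    have "(\<Sum>a\<in>A'. \<gamma> a * M' a x) = (\<Sum>a\<in>A'. \<gamma> a * M a x) - s / M a0 b * M a0 x" for x
      unfolding s_def M'_def
      by (simp add: right_diff_distrib sum_subtractf sum_distrib_right sum_divide_distrib mult.assoc)
    then have "\<forall>x\<in>B. (\<Sum>a\<in>A. \<delta> a * M a x) = 0" using \<gamma>(2) sum_\<delta> by simp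
    moreover have "(\<Sum>a\<in>A. \<delta> a * M a b) = 0" using sum_\<delta>[of b] a0 by (simp add: s_def)
    moreover have "\<exists>a\<in>A. \<delta> a \<noteq> 0" using \<gamma>(1) by (auto simp: \<delta>_def A'_def)
    ultimately show ?thesis by (intro exI[of _ \<delta>]) auto
  qed
qed

text \<open>Degree is a property of functions, so it applies directly to determinants with entries
  in \<open>z\<close> and \<open>w\<close>; rule induction over monomials and sums takes the place
  of coefficients.\<close>

inductive deg_le :: "nat \<Rightarrow> (complex \<Rightarrow> complex \<Rightarrow> complex) \<Rightarrow> bool" for n where
  monom: "i + j \<le> n \<Longrightarrow> deg_le n (\<lambda>z w. k * z ^ i * w ^ j)"
| add: "deg_le n f \<Longrightarrow> deg_le n g \<Longrightarrow> deg_le n (\<lambda>z w. f z w + g z w)"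

lemma deg_le_const: "deg_le n (\<lambda>z w. k)"
  using deg_le.monom[of 0 0 n k] by simp

lemma deg_le_z: "n \<ge> 1 \<Longrightarrow> deg_le n (\<lambda>z w. z)"
  using deg_le.monom[of 1 0 n 1] by simp

lemma deg_le_w: "n \<ge> 1 \<Longrightarrow> deg_le n (\<lambda>z w. w)"
  using deg_le.monom[of 0 1 n 1] by simp

lemma deg_le_mono: "deg_le n f \<Longrightarrow> n \<le> n' \<Longrightarrow> deg_le n' f"
  by (induction rule: deg_le.induct) (auto intro: deg_le.intros)

lemma deg_le_mult_monom:
  "deg_le n f \<Longrightarrow> i + j \<le> n' \<Longrightarrow> deg_le (n' + n) (\<lambda>z w. k * z ^ i * w ^ j * f z w)"
proof (induction rule: deg_le.induct)
  case (monom i' j' k')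
  have "deg_le (n' + n) (\<lambda>z w. (k * k') * z ^ (i + i') * w ^ (j + j'))"
    using monom by (intro deg_le.monom) auto
  then show ?case by (simp add: power_add mult_ac)
next
  case (add f g)
  then show ?case using deg_le.add by (fastforce simp: distrib_left)
qed

lemma deg_le_mult:
  "deg_le n f \<Longrightarrow> deg_le n' g \<Longrightarrow> deg_le (n + n') (\<lambda>z w. f z w * g z w)"
proof (induction rule: deg_le.induct)
  case (monom i j k)
  then show ?case using deg_le_mult_monom by blast
next
  case (add f h)
  then show ?case using deg_le.add by (fastforce simp: distrib_right)
qed

lemma deg_le_scale: "deg_le n f \<Longrightarrow> deg_le n (\<lambda>z w. k * f z w)"
  using deg_le_mult[OF deg_le_const[of 0]] by fastforce

lemma deg_le_sum:
  "(\<And>i. i \<in> S \<Longrightarrow> deg_le n (f i)) \<Longrightarrow> deg_le n (\<lambda>z w. \<Sum>i\<in>S. f i z w)"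
  by (induction S rule: infinite_finite_induct) (auto intro: deg_le_const deg_le.add)

lemma deg_le_prod:
  "finite S \<Longrightarrow> (\<And>i. i \<in> S \<Longrightarrow> deg_le (d i) (f i)) \<Longrightarrow>
     deg_le (\<Sum>i\<in>S. d i) (\<lambda>z w. \<Prod>i\<in>S. f i z w)"
  by (induction S rule: finite_induct) (auto intro: deg_le_const deg_le_mult)

lemma deg_le_differentiable:
  assumes "deg_le n f"
  shows "(\<lambda>x. f (x + u) (x + v)) field_differentiable at x0"
  using assms
  by (induction rule: deg_le.induct) (auto intro!: derivative_intros)

lemma delete_col_A_mat:
  assumes "k \<le> m"
  shows "delete_col (A_mat a c m z w) (m - k) = Matrix.mat m m (\<lambda>(i, j).
    let j' = (if j < m - k then j else j + 1) in
     if j' = i then z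
     else if j' = i + 1 then w
     else if j' = i + 2 then (if i = 0 then cnj a else cnj c)
     else if i = j' + 1 then (if i = m - 1 then a else c)
     else 0)"
  unfolding delete_col_def A_mat_def
  by (rule eq_matI) (auto simp: insert_index_def Let_def)

text \<open>Deleting column \<open>l\<close> leaves the entries \<open>z\<close> and
  \<open>w\<close> in two diagonal blocks, the first upper and the second lower triangular.
  Injectivity pins the last row of the first block and the first row of the second, then their
  neighbours in turn.\<close>

lemma permutes_bidiagonal_eq_id:
  fixes l m :: nat
  assumes p: "p permutes {0..<m}"
    and lo: "\<And>i. i < l \<Longrightarrow> i < m \<Longrightarrow> i \<le> p i \<and> p i < l"
    and hi: "\<And>i. l \<le> i \<Longrightarrow> i < m \<Longrightarrow> p i \<le> i \<and> l \<le> p i"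
  shows "p = id"
proof -
  have inj: "p i = p j \<Longrightarrow> i = j" for i j
    using permutes_inj[OF p] by (auto dest: injD)
  have high: "l \<le> i \<Longrightarrow> i < m \<Longrightarrow> p i = i" for i :: nat
  proof (induction i rule: less_induct)
    case (less i)
    then show ?case using hi[of i] inj[of "p i" i]
      by (metis le_less_trans nat_less_le)
  qed
  have low: "i < l \<Longrightarrow> i < m \<Longrightarrow> p i = i" for i
  proof (induction "m - i" arbitrary: i rule: less_induct)
    case less
    have "p i < m" using permutes_in_image[OF p, of i] less by simp
    then have "p i > i \<Longrightarrow> p (p i) = p i" using less lo[of i] by force
    then show ?case using lo[of i] less.prems inj[of "p i" i] by fastforce
  qed
  show ?thesis
  proof
    fix i show "p i = id i"
      using low[of i] high[of i] permutes_not_in[OF p, of i] by (cases "i < m"; cases "i < l") auto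
  qed
qed

text \<open>In the Leibniz expansion the identity gives \<open>z ^ (m - k) * w ^ k\<close>; any
  other permutation meets a constant entry and loses at least one degree.\<close>

lemma Q_poly_leading_term:
  assumes "k \<le> m" "m \<ge> 1"
  obtains R where "deg_le (m - 1) R" "\<And>z w. Q_poly a c m k z w = z ^ (m - k) * w ^ k + R z w"
proof -
  define l where "l = m - k"
  define M where "M = (\<lambda>z w. Matrix.mat m m (\<lambda>(i, j).
    let j' = (if j < l then j else j + 1) in
     if j' = i then z
     else if j' = i + 1 then w
     else if j' = i + 2 then (if i = 0 then cnj a else cnj c)
     else if i = j' + 1 then (if i = m - 1 then a else c)
     else 0))"
  define S where "S = {p. p permutes {0..<m}}"
  define T where "T = (\<lambda>p z w. signof p * (\<Prod>i = 0..<m. M z w $$ (i, p i)))"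
  define R where "R = (\<lambda>z w. \<Sum>p\<in>S - {id}. T p z w)"
  have fin: "finite S" unfolding S_def by (simp add: finite_permutations)
  have idS: "id \<in> S" by (simp add: S_def permutes_id)
  have "Q_poly a c m k z w = T id z w + R z w" for z w
  proof -
    have delete_eq: "delete_col (A_mat a c m z w) (m - k) = M z w"
      by (simp add: delete_col_A_mat[OF assms(1)] M_def l_def)
    have "Q_poly a c m k z w = (\<Sum>p\<in>S. T p z w)"
      unfolding Q_poly_def delete_eq S_def T_def
      by (rule det_def') (simp add: M_def)
    then show ?thesis unfolding R_def using sum.remove[OF fin idS] by simp
  qed
  moreover have "T id z w = z ^ l * w ^ k" for z w
  proof -
    have "(\<Prod>i = 0..<m. M z w $$ (i, i)) = (\<Prod>i = 0..<m. if i < l then z else w)"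
      by (rule prod.cong) (auto simp: M_def)
    also have "\<dots> = (\<Prod>i\<in>{0..<l}. if i < l then z else w) * (\<Prod>i\<in>{l..<m}. if i < l then z else w)"
      by (subst prod.atLeastLessThan_concat) (auto simp: l_def)
    also have "\<dots> = z ^ l * w ^ k" using assms(1) by (simp add: l_def)
    finally show ?thesis by (simp add: T_def)
  qed
  moreover have "deg_le (m - 1) (T p)" if p: "p \<in> S - {id}" for p
  proof -
    have perm: "p permutes {0..<m}" using p by (simp add: S_def)
    have pm: "p i < m" if "i < m" for i using permutes_in_image[OF perm, of i] that by simp
    \<comment> \<open>The two conditions describe exactly the positions of \<open>z\<close> and
      \<open>w\<close>, so the row violating them contributes a constant.\<close>
    have "\<exists>i<m. \<not> (i < l \<longrightarrow> i \<le> p i \<and> p i < l \<and> p i \<le> i + 1) \<or>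
                \<not> (l \<le> i \<longrightarrow> p i \<le> i \<and> l \<le> p i \<and> i \<le> p i + 1)"
      using permutes_bidiagonal_eq_id[OF perm, of l] p by (metis DiffD2 insertI1 not_le)
    then obtain i0 where i0: "i0 < m" "\<not> (i0 < l \<longrightarrow> i0 \<le> p i0 \<and> p i0 < l \<and> p i0 \<le> i0 + 1) \<or>
                \<not> (l \<le> i0 \<longrightarrow> p i0 \<le> i0 \<and> l \<le> p i0 \<and> i0 \<le> p i0 + 1)" by blast
    define d where "d = (\<lambda>i::nat. if i = i0 then 0 else 1 :: nat)"
    have "deg_le (d i) (\<lambda>z w. M z w $$ (i, p i))" if i: "i \<in> {0..<m}" for i
    proof (cases "i = i0")
      case True
      then have "(\<lambda>z w. M z w $$ (i, p i)) = (\<lambda>z w. M 0 0 $$ (i, p i))"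
        using i0 i pm[of i] by (intro ext) (auto simp: M_def Let_def)
      then show ?thesis using deg_le_const by metis
    next
      case False
      have "(\<lambda>z w. M z w $$ (i, p i)) = (\<lambda>z w. z) \<or> (\<lambda>z w. M z w $$ (i, p i)) = (\<lambda>z w. w) \<or>
        (\<lambda>z w. M z w $$ (i, p i)) = (\<lambda>z w. M 0 0 $$ (i, p i))"
        using i pm[of i] by (auto simp: M_def Let_def)
      then have "deg_le 1 (\<lambda>z w. M z w $$ (i, p i))"
        by (elim disjE) (simp_all only: deg_le_const deg_le_z deg_le_w order_refl)
      then show ?thesis using False by (simp add: d_def)
    qed
    then have "deg_le (\<Sum>i = 0..<m. d i) (\<lambda>z w. \<Prod>i = 0..<m. M z w $$ (i, p i))"
      by (intro deg_le_prod) auto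
    moreover have "(\<Sum>i = 0..<m. d i) = m - 1"
    proof -
      have "(\<Sum>i = 0..<m. d i) = d i0 + (\<Sum>i\<in>{0..<m} - {i0}. d i)"
        using i0 by (intro sum.remove) auto
      also have "(\<Sum>i\<in>{0..<m} - {i0}. d i) = (\<Sum>i\<in>{0..<m} - {i0}. 1)"
        by (intro sum.cong) (auto simp: d_def)
      finally show ?thesis using i0 by (simp add: d_def)
    qed
    ultimately show ?thesis unfolding T_def using deg_le_scale by simp
  qed
  then have "deg_le (m - 1) R" unfolding R_def by (intro deg_le_sum) auto
  ultimately show ?thesis using that by (simp add: l_def)
qed

section \<open>Functionals annihilating the ideal\<close>

text \<open>Linearity is required only on polynomial functions, where differentiability makes
  \<open>deriv_x\<close> linear.\<close>

definition poly_functional :: "((complex \<Rightarrow> complex \<Rightarrow> complex) \<Rightarrow> complex) \<Rightarrow> bool" where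
  "poly_functional L \<longleftrightarrow>
     (\<forall>n f g. deg_le n f \<longrightarrow> deg_le n g \<longrightarrow> L (\<lambda>z w. f z w + g z w) = L f + L g) \<and>
     (\<forall>n f k. deg_le n f \<longrightarrow> L (\<lambda>z w. k * f z w) = k * L f)"

lemma poly_functional_add:
  assumes "poly_functional L" "deg_le n f" "deg_le n' g"
  shows "L (\<lambda>z w. f z w + g z w) = L f + L g"
  using assms deg_le_mono[of n f "max n n'"] deg_le_mono[of n' g "max n n'"]
  unfolding poly_functional_def by (metis max.cobounded1 max.cobounded2)

lemma poly_functional_scale:
  "poly_functional L \<Longrightarrow> deg_le n f \<Longrightarrow> L (\<lambda>z w. k * f z w) = k * L f"
  unfolding poly_functional_def by blast

lemma poly_functional_sum:
  assumes "\<And>i. i \<in> I \<Longrightarrow> poly_functional (\<phi> i)"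
  shows "poly_functional (\<lambda>f. \<Sum>i\<in>I. \<gamma> i * \<phi> i f)"
  unfolding poly_functional_def
proof (intro conjI allI impI)
  fix n f g assume "deg_le n f" "deg_le n g"
  then have "\<And>i. i \<in> I \<Longrightarrow> \<phi> i (\<lambda>z w. f z w + g z w) = \<phi> i f + \<phi> i g"
    using assms poly_functional_add by blast
  then show "(\<Sum>i\<in>I. \<gamma> i * \<phi> i (\<lambda>z w. f z w + g z w)) =
      (\<Sum>i\<in>I. \<gamma> i * \<phi> i f) + (\<Sum>i\<in>I. \<gamma> i * \<phi> i g)"
    by (simp add: distrib_left sum.distrib cong: sum.cong)
next
  fix n f k assume "deg_le n f"
  then have "\<And>i. i \<in> I \<Longrightarrow> \<phi> i (\<lambda>z w. k * f z w) = k * \<phi> i f"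
    using assms poly_functional_scale by blast
  then show "(\<Sum>i\<in>I. \<gamma> i * \<phi> i (\<lambda>z w. k * f z w)) = k * (\<Sum>i\<in>I. \<gamma> i * \<phi> i f)"
    by (simp add: sum_distrib_left mult_ac cong: sum.cong)
qed

lemma poly_functional_zero:
  assumes L: "poly_functional L"
    and "deg_le n f" "\<And>i j. i + j \<le> n \<Longrightarrow> L (\<lambda>z w. z ^ i * w ^ j) = 0"
  shows "L f = 0"
  using assms(2,3)
proof (induction rule: deg_le.induct)
  case (monom i j k)
  have "deg_le (i + j) (\<lambda>z w. z ^ i * w ^ j)" using deg_le.monom[of i j "i + j" 1] by simp
  from poly_functional_scale[OF L this, of k] show ?case using monom by (simp add: mult.assoc)
next
  case (add f g)
  then show ?case using poly_functional_add[OF L] by fastforce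
qed

text \<open>By linearity, vanishing on monomial multiples of the generators means vanishing on the
  ideal.\<close>

definition annihilates :: "complex \<Rightarrow> complex \<Rightarrow> nat \<Rightarrow> ((complex \<Rightarrow> complex \<Rightarrow> complex) \<Rightarrow> complex) \<Rightarrow> bool" where
  "annihilates a c m L \<longleftrightarrow>
     (\<forall>i j. \<forall>k\<le>m. L (\<lambda>z w. z ^ i * w ^ j * Q_poly a c m k z w) = 0)"

lemma deg_le_Q_poly:
  assumes "k \<le> m" "m \<ge> 1"
  shows "deg_le m (Q_poly a c m k)"
proof -
  obtain R where R: "deg_le (m - 1) R" "\<And>z w. Q_poly a c m k z w = z ^ (m - k) * w ^ k + R z w"
    using Q_poly_leading_term[OF assms] by blast
  have "deg_le m (\<lambda>z w. 1 * z ^ (m - k) * w ^ k + R z w)"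
    using assms R(1) deg_le_mono[OF R(1), of m] by (intro deg_le.add deg_le.monom) auto
  moreover have "Q_poly a c m k = (\<lambda>z w. 1 * z ^ (m - k) * w ^ k + R z w)"
    using R(2) by (intro ext) simp
  ultimately show ?thesis by simp
qed

text \<open>The leading terms of \<open>Q_poly\<close> run through all monomials of degree
  \<open>m\<close>, so a monomial of degree at least \<open>m\<close> reduces modulo the ideal to
  lower degree, where induction applies.\<close>

lemma annihilates_low_degree_imp_zero:
  assumes "m \<ge> 1" and L: "poly_functional L" "annihilates a c m L"
    and low: "\<And>i j. i + j < m \<Longrightarrow> L (\<lambda>z w. z ^ i * w ^ j) = 0"
    and f: "deg_le n f"
  shows "L f = 0"
proof -
  have "L (\<lambda>z w. z ^ i * w ^ j) = 0" for i j
  proof (induction "i + j" arbitrary: i j rule: less_induct)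
    case less
    show ?case
    proof (cases "i + j < m")
      case False
      \<comment> \<open>As \<open>i + j \<ge> m\<close>, this choice makes
        \<open>z ^ (m - k) * w ^ k\<close> divide \<open>z ^ i * w ^ j\<close>.\<close>
      define k where "k = min j m"
      define i' j' where "i' = i - (m - k)" and "j' = j - k"
      have k: "k \<le> m" "k \<le> j" "m - k \<le> i" using False by (auto simp: k_def)
      obtain R where R: "deg_le (m - 1) R" "\<And>z w. Q_poly a c m k z w = z ^ (m - k) * w ^ k + R z w"
        using Q_poly_leading_term[OF k(1) assms(1)] by blast
      let ?R = "\<lambda>z w. (-1) * z ^ i' * w ^ j' * R z w"
      have deg: "deg_le (i' + j' + (m - 1)) ?R" by (rule deg_le_mult_monom[OF R(1)]) simp
      have "deg_le (i' + j' + m) (\<lambda>z w. 1 * z ^ i' * w ^ j' * Q_poly a c m k z w)"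
        by (rule deg_le_mult_monom[OF deg_le_Q_poly[OF k(1) assms(1)]]) simp
      then have degQ: "deg_le (i' + j' + m) (\<lambda>z w. z ^ i' * w ^ j' * Q_poly a c m k z w)" by simp
      have "z ^ i * w ^ j = z ^ i' * w ^ j' * Q_poly a c m k z w + ?R z w" for z w
      proof -
        have "z ^ i = z ^ i' * z ^ (m - k)" "w ^ j = w ^ j' * w ^ k"
          using k by (simp_all add: i'_def j'_def flip: power_add)
        then show ?thesis by (simp add: R(2) algebra_simps)
      qed
      then have "L (\<lambda>z w. z ^ i * w ^ j) =
          L (\<lambda>z w. z ^ i' * w ^ j' * Q_poly a c m k z w) + L ?R"
        using poly_functional_add[OF L(1) degQ deg] by simp
      moreover have "L (\<lambda>z w. z ^ i' * w ^ j' * Q_poly a c m k z w) = 0"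
        using L(2) k(1) unfolding annihilates_def by blast
      moreover have "L ?R = 0"
      proof (rule poly_functional_zero[OF L(1) deg])
        fix p q assume pq: "p + q \<le> i' + j' + (m - 1)"
        have "i' + j' + m = i + j" using k by (simp add: i'_def j'_def)
        then have "p + q < i + j" using pq assms(1) by linarith
        then show "L (\<lambda>z w. z ^ p * w ^ q) = 0" by (rule less)
      qed
      ultimately show ?thesis by simp
    qed (use low in blast)
  qed
  then show ?thesis using poly_functional_zero[OF L(1) f] by blast
qed

lemma card_sum_less: "card {(i, j). i + j < m} = (m + 1) choose 2"
proof -
  have "{(i, j). i + j < m} = (SIGMA i:{..<m}. {..<m - i})" by auto
  then have "card {(i, j). i + j < m} = (\<Sum>i<m. m - i)" by (simp add: card_SigmaI)
  also have "\<dots> = (m + 1) choose 2"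
  proof (induction m)
    case (Suc m)
    have "(\<Sum>i<Suc m. Suc m - i) = Suc m + (\<Sum>i<m. m - i)"
      by (subst sum.lessThan_Suc_shift) simp
    then show ?case using Suc by (simp add: numeral_2_eq_2)
  qed simp
  finally show ?thesis .
qed

lemma finite_sum_less: "finite {(i, j). i + j < (m::nat)}"
  by (rule finite_subset[of _ "{..<m} \<times> {..<m}"]) auto

text \<open>There are \<open>(m + 1) choose 2\<close> monomials of degree below \<open>m\<close>.
  More functionals than that have a nontrivial combination vanishing on all of them, hence on every
  polynomial by \<open>annihilates_low_degree_imp_zero\<close>.\<close>

lemma annihilating_functionals_dependent:
  assumes "m \<ge> 1" "finite I" "(m + 1) choose 2 < card I"
    and \<phi>: "\<And>i. i \<in> I \<Longrightarrow> poly_functional (\<phi> i)" "\<And>i. i \<in> I \<Longrightarrow> annihilates a c m (\<phi> i)"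
  shows "\<exists>\<gamma>. (\<exists>i\<in>I. \<gamma> i \<noteq> 0) \<and> (\<forall>n f. deg_le n f \<longrightarrow> (\<Sum>i\<in>I. \<gamma> i * \<phi> i f) = 0)"
proof -
  have "card {(i, j). i + j < m} < card I" using assms by (simp only: card_sum_less)
  then obtain \<gamma> where \<gamma>: "\<exists>i\<in>I. \<gamma> i \<noteq> 0"
    "\<forall>b\<in>{(i, j). i + j < m}. (\<Sum>l\<in>I. \<gamma> l * \<phi> l (\<lambda>z w. z ^ fst b * w ^ snd b)) = 0"
    using exists_nontrivial_relation[OF finite_sum_less assms(2),
        of m "\<lambda>l b. \<phi> l (\<lambda>z w. z ^ fst b * w ^ snd b)"] by blast
  have "(\<Sum>i\<in>I. \<gamma> i * \<phi> i f) = 0" if "deg_le n f" for n f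
  proof (rule annihilates_low_degree_imp_zero[OF assms(1) _ _ _ that, where L = "\<lambda>f. \<Sum>i\<in>I. \<gamma> i * \<phi> i f"])
    show "poly_functional (\<lambda>f. \<Sum>i\<in>I. \<gamma> i * \<phi> i f)"
      using \<phi>(1) by (rule poly_functional_sum)
    show "annihilates a c m (\<lambda>f. \<Sum>i\<in>I. \<gamma> i * \<phi> i f)"
      using \<phi>(2) unfolding annihilates_def by simp
    show "(\<Sum>l\<in>I. \<gamma> l * \<phi> l (\<lambda>z w. z ^ i * w ^ j)) = 0" if "i + j < m" for i j
      using \<gamma>(2) that by auto
  qed
  then show ?thesis using \<gamma>(1) by blast
qed

section \<open>Evaluation and derivative functionals, and the upper bound\<close>

definition eval_xy :: "complex \<times> complex \<Rightarrow> (complex \<Rightarrow> complex \<Rightarrow> complex) \<Rightarrow> complex" where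
  "eval_xy p f = f (fst p + \<i> * snd p) (fst p - \<i> * snd p)"

definition deriv_x :: "complex \<times> complex \<Rightarrow> (complex \<Rightarrow> complex \<Rightarrow> complex) \<Rightarrow> complex" where
  "deriv_x p f = deriv (\<lambda>x. f (x + \<i> * snd p) (x - \<i> * snd p)) (fst p)"

lemma poly_functional_eval_xy: "poly_functional (eval_xy p)"
  by (simp add: poly_functional_def eval_xy_def)

lemma deg_le_differentiable_x:
  "deg_le n f \<Longrightarrow> (\<lambda>x. f (x + \<i> * v) (x - \<i> * v)) field_differentiable at u"
  using deg_le_differentiable[of n f "\<i> * v" "- \<i> * v" u] by simp

lemma poly_functional_deriv_x: "poly_functional (deriv_x p)"
  by (auto simp: poly_functional_def deriv_x_def deg_le_differentiable_x)

lemma deriv_x_mult: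
  assumes "deg_le n f" "deg_le n' g"
  shows "deriv_x p (\<lambda>z w. f z w * g z w) = eval_xy p f * deriv_x p g + deriv_x p f * eval_xy p g"
  unfolding deriv_x_def eval_xy_def
  using assms by (subst deriv_mult) (auto intro: deg_le_differentiable_x)

lemma annihilates_eval_xy:
  assumes "p \<in> common_zeros a c m"
  shows "annihilates a c m (eval_xy p)"
  using assms by (auto simp: annihilates_def eval_xy_def common_zeros_def Q_xy_def)

text \<open>Product rule: the value and the \<open>x\<close>-derivative of each generator both
  vanish at \<open>p\<close>.\<close>

lemma annihilates_deriv_x:
  assumes "p \<in> common_zeros a c m" "m \<ge> 1"
    and "\<forall>k\<le>m. deriv (\<lambda>x. Q_xy a c m k x (snd p)) (fst p) = 0"
  shows "annihilates a c m (deriv_x p)"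
  unfolding annihilates_def
proof (intro allI impI)
  fix i j k assume k: "k \<le> m"
  have "deg_le (i + j) (\<lambda>z w. z ^ i * w ^ j)" using deg_le.monom[of i j "i + j" 1] by simp
  from deriv_x_mult[OF this deg_le_Q_poly[OF k assms(2)], of p a c]
  show "deriv_x p (\<lambda>z w. z ^ i * w ^ j * Q_poly a c m k z w) = 0"
    using assms k
    by (auto simp: deriv_x_def eval_xy_def common_zeros_def Q_xy_def case_prod_beta)
qed

lemma separating_polynomial:
  assumes "finite Z"
  shows "\<exists>n f. deg_le n f \<and> eval_xy p f \<noteq> 0 \<and> (\<forall>q\<in>Z - {p}. eval_xy q f = 0)"
proof -
  \<comment> \<open>\<open>x q\<close> and \<open>y q\<close> are the values of \<open>z\<close> and
    \<open>w\<close> at \<open>q\<close>; distinct points differ in at least one of them, which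
    decides the linear factor that kills \<open>q\<close> but not \<open>p\<close>.\<close>
  define x where "x = (\<lambda>q :: complex \<times> complex. fst q + \<i> * snd q)"
  define y where "y = (\<lambda>q :: complex \<times> complex. fst q - \<i> * snd q)"
  define l where "l = (\<lambda>q z w. if x q \<noteq> x p then z - x q else w - y q)"
  define f where "f = (\<lambda>z w. \<Prod>q\<in>Z - {p}. l q z w)"
  have inj: "x q = x q' \<Longrightarrow> y q = y q' \<Longrightarrow> q = q'" for q q'
  proof -
    assume *: "x q = x q'" "y q = y q'"
    have "2 * fst q = x q + y q" "2 * fst q' = x q' + y q'"
      "2 * (\<i> * snd q) = x q - y q" "2 * (\<i> * snd q') = x q' - y q'"
      by (simp_all add: x_def y_def)
    then have "2 * fst q = 2 * fst q'" "2 * (\<i> * snd q) = 2 * (\<i> * snd q')"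
      by (simp_all only: *)
    then have "fst q = fst q'" "snd q = snd q'" by simp_all
    then show ?thesis by (rule prod_eqI)
  qed
  have "deg_le 1 (l q)" for q
  proof -
    have "deg_le 1 (\<lambda>z w. z + (- x q))" "deg_le 1 (\<lambda>z w. w + (- y q))"
      by (intro deg_le.add deg_le_z deg_le_w deg_le_const order_refl)+
    then show ?thesis unfolding l_def by (cases "x q = x p") simp_all
  qed
  then have "deg_le (\<Sum>q\<in>Z - {p}. 1) f"
    unfolding f_def using assms by (intro deg_le_prod) auto
  moreover have "eval_xy q f = f (x q) (y q)" for q by (simp add: eval_xy_def x_def y_def)
  moreover have "f (x p) (y p) \<noteq> 0"
  proof -
    have "l q (x p) (y p) \<noteq> 0" if "q \<noteq> p" for q
      using inj[of q p] that by (auto simp: l_def)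
    then show ?thesis unfolding f_def using assms by simp
  qed
  moreover have "f (x q) (y q) = 0" if "q \<in> Z" "q \<noteq> p" for q
    unfolding f_def using assms that by (auto simp: l_def)
  ultimately show ?thesis
    by (intro exI[of _ "\<Sum>q\<in>Z - {p}. 1"] exI[of _ f] conjI ballI) simp_all
qed

text \<open>Evaluations at distinct points are independent, as separating polynomials show, and
  those at zeros annihilate the ideal. Bounding every finite set of zeros first also yields
  finiteness.\<close>

lemma card_common_zeros_le:
  assumes "m \<ge> 1"
  shows "finite (common_zeros a c m)" "card (common_zeros a c m) \<le> (m + 1) choose 2"
proof -
  have "card Z \<le> (m + 1) choose 2" if Z: "finite Z" "Z \<subseteq> common_zeros a c m" for Z
  proof (rule ccontr)
    assume "\<not> card Z \<le> (m + 1) choose 2"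
    then have "(m + 1) choose 2 < card Z" by simp
    moreover have "annihilates a c m (eval_xy q)" if "q \<in> Z" for q
      using that Z(2) annihilates_eval_xy by blast
    ultimately have "\<exists>\<gamma>. (\<exists>q\<in>Z. \<gamma> q \<noteq> 0) \<and>
        (\<forall>n f. deg_le n f \<longrightarrow> (\<Sum>q\<in>Z. \<gamma> q * eval_xy q f) = 0)"
      by (rule annihilating_functionals_dependent[OF assms Z(1) _ poly_functional_eval_xy])
    then obtain \<gamma> p where *: "p \<in> Z" "\<gamma> p \<noteq> 0"
      "\<And>n f. deg_le n f \<Longrightarrow> (\<Sum>q\<in>Z. \<gamma> q * eval_xy q f) = 0" by blast
    obtain n f where f: "deg_le n f" "eval_xy p f \<noteq> 0"
      "\<And>q. q \<in> Z \<Longrightarrow> q \<noteq> p \<Longrightarrow> eval_xy q f = 0"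
      using separating_polynomial[OF Z(1), of p] by blast
    have "(\<Sum>q\<in>Z. \<gamma> q * eval_xy q f) = \<gamma> p * eval_xy p f + (\<Sum>q\<in>Z - {p}. \<gamma> q * eval_xy q f)"
      using * Z by (intro sum.remove) auto
    also have "(\<Sum>q\<in>Z - {p}. \<gamma> q * eval_xy q f) = 0"
      using f(3) by (intro sum.neutral) auto
    finally show False using *(2) *(3)[OF f(1)] f(2) by simp
  qed
  note bound = this
  show fin: "finite (common_zeros a c m)"
  proof (rule ccontr)
    assume "infinite (common_zeros a c m)"
    then obtain Z where "finite Z" "card Z = Suc ((m + 1) choose 2)" "Z \<subseteq> common_zeros a c m"
      using infinite_arbitrarily_large by blast
    then show False using bound[of Z] by simp
  qed
  show "card (common_zeros a c m) \<le> (m + 1) choose 2" using bound[OF fin] by simp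
qed

text \<open>
  A zero of higher multiplicity contributes the \<open>x\<close>-derivative as a further functional that
  annihilates the ideal.
\<close>

lemma simple_zero_if_card_common_zeros:
  assumes "m \<ge> 1" "card (common_zeros a c m) = (m + 1) choose 2" "p \<in> common_zeros a c m"
  shows "simple_zero a c m p"
proof (rule ccontr)
  assume "\<not> simple_zero a c m p"
  then have d: "\<forall>k\<le>m. deriv (\<lambda>x. Q_xy a c m k x (snd p)) (fst p) = 0"
    using assms(3) unfolding simple_zero_def by blast
  define Z where "Z = common_zeros a c m"
  have Z: "finite Z" "p \<in> Z" using card_common_zeros_le[OF assms(1)] assms(3) by (auto simp: Z_def)
  \<comment> \<open>\<open>None\<close> stands for the derivative at \<open>p\<close>,
    \<open>Some q\<close> for evaluation at \<open>q\<close>: one functional more than independence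
    allows.\<close>
  define \<phi> where "\<phi> = (\<lambda>i. case i of None \<Rightarrow> deriv_x p | Some q \<Rightarrow> eval_xy q)"
  define I where "I = insert None (Some ` Z)"
  have I: "finite I" "(m + 1) choose 2 < card I"
    using Z assms(2) by (auto simp: I_def Z_def card_image card_insert_if)
  have "poly_functional (\<phi> i)" for i
    by (cases i) (simp_all add: \<phi>_def poly_functional_eval_xy poly_functional_deriv_x)
  moreover have "annihilates a c m (\<phi> i)" if "i \<in> I" for i
    using that annihilates_eval_xy annihilates_deriv_x[OF assms(3,1) d]
    by (auto simp: \<phi>_def I_def Z_def)
  ultimately have "\<exists>\<gamma>. (\<exists>i\<in>I. \<gamma> i \<noteq> 0) \<and>
      (\<forall>n f. deg_le n f \<longrightarrow> (\<Sum>i\<in>I. \<gamma> i * \<phi> i f) = 0)"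
    by (rule annihilating_functionals_dependent[OF assms(1) I])
  then obtain \<gamma> i0 where \<gamma>: "i0 \<in> I" "\<gamma> i0 \<noteq> 0"
    "\<And>n f. deg_le n f \<Longrightarrow> (\<Sum>i\<in>I. \<gamma> i * \<phi> i f) = 0" by blast
  have sum_I: "(\<Sum>i\<in>I. \<gamma> i * \<phi> i f) = \<gamma> None * deriv_x p f + (\<Sum>q\<in>Z. \<gamma> (Some q) * eval_xy q f)" for f
    unfolding I_def using Z by (subst sum.insert) (auto simp: \<phi>_def sum.reindex)
  have sum_Z: "(\<Sum>q\<in>Z. \<gamma> (Some q) * eval_xy q f) = \<gamma> (Some r) * eval_xy r f"
    if "r \<in> Z" "\<And>q. q \<in> Z \<Longrightarrow> q \<noteq> r \<Longrightarrow> eval_xy q f = 0" for f r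
  proof -
    have "(\<Sum>q\<in>Z. \<gamma> (Some q) * eval_xy q f) =
        \<gamma> (Some r) * eval_xy r f + (\<Sum>q\<in>Z - {r}. \<gamma> (Some q) * eval_xy q f)"
      using that Z by (intro sum.remove) auto
    also have "(\<Sum>q\<in>Z - {r}. \<gamma> (Some q) * eval_xy q f) = 0"
      using that by (intro sum.neutral) auto
    finally show ?thesis by simp
  qed
  have other: "\<gamma> (Some r) = 0" if r: "r \<in> Z" "r \<noteq> p" for r
  proof -
    obtain n f where f: "deg_le n f" "eval_xy r f \<noteq> 0"
      "\<And>q. q \<in> Z \<Longrightarrow> q \<noteq> r \<Longrightarrow> eval_xy q f = 0"
      using separating_polynomial[OF Z(1), of r] by blast
    \<comment> \<open>The square of a polynomial vanishing at \<open>p\<close> also has derivative 0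
      there, so only the term of \<open>r\<close> survives.\<close>
    let ?g = "\<lambda>z w. f z w * f z w"
    have ev: "eval_xy q ?g = eval_xy q f * eval_xy q f" for q by (simp add: eval_xy_def)
    have "deriv_x p ?g = 0" using deriv_x_mult[OF f(1) f(1)] f(3)[OF Z(2)] r by simp
    moreover have "(\<Sum>q\<in>Z. \<gamma> (Some q) * eval_xy q ?g) = \<gamma> (Some r) * eval_xy r ?g"
      using r f(3) ev by (intro sum_Z) auto
    ultimately show ?thesis using \<gamma>(3)[OF deg_le_mult[OF f(1) f(1)]] sum_I[of ?g] ev f(2) by simp
  qed
  obtain n f where f: "deg_le n f" "eval_xy p f \<noteq> 0"
      "\<And>q. q \<in> Z \<Longrightarrow> q \<noteq> p \<Longrightarrow> eval_xy q f = 0"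
      using separating_polynomial[OF Z(1), of p] by blast
  have total: "\<gamma> None * deriv_x p g + \<gamma> (Some p) * eval_xy p g = 0" if "deg_le n g" for n g
  proof -
    have "(\<Sum>q\<in>Z. \<gamma> (Some q) * eval_xy q g) = \<gamma> (Some p) * eval_xy p g"
      using other Z sum.remove[OF Z, of "\<lambda>q. \<gamma> (Some q) * eval_xy q g"] by simp
    then show ?thesis using \<gamma>(3)[OF that] sum_I[of g] by simp
  qed
  \<comment> \<open>The constant 1 has derivative 0 and isolates \<open>\<gamma> (Some p)\<close>;
    the function \<open>z\<close>, with \<open>x\<close>-derivative 1, then isolates
    \<open>\<gamma> None\<close>.\<close>
  have "\<gamma> (Some p) = 0" using total[OF deg_le_const[of 0 1]] by (simp add: deriv_x_def eval_xy_def)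
  moreover have "\<gamma> None = 0"
  proof -
    have "deg_le 1 (\<lambda>z w. z)" by (simp add: deg_le_z)
    moreover have "deriv_x p (\<lambda>z w. z) = 1" by (simp add: deriv_x_def)
    ultimately show ?thesis using total[of 1 "\<lambda>z w. z"] \<open>\<gamma> (Some p) = 0\<close> by simp
  qed
  ultimately show False using other \<gamma>(1,2) by (auto simp: I_def)
qed

section \<open>The dimension of the polynomial space\<close>

text \<open>The monomials of total degree at most \<open>n\<close> form a basis: extracting a double
  coefficient recovers each scalar, which gives both spanning and independence.\<close>

lemma dim_Pi2_eq: "dim_Pi2 n = (n + 2) choose 2"
proof -
  interpret V: vector_space "\<lambda>(r::real) p. Polynomial.smult [:r:] p"
    by unfold_locales (auto intro!: poly_eqI simp: algebra_simps)
  define S where "S = {(i, j). i + j < Suc n}"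
  define b where "b = (\<lambda>(i, j). Polynomial.monom (Polynomial.monom (1::real) j) i)"
  have fin: "finite S" unfolding S_def by (rule finite_sum_less)
  have coeff_b: "Polynomial.coeff (Polynomial.coeff (b x) k) l = (if x = (k, l) then 1 else 0)" for x k l
    by (cases x) (auto simp: b_def)
  have coeff_sum: "Polynomial.coeff (Polynomial.coeff (\<Sum>x\<in>S. Polynomial.smult [:g x:] (b x)) k) l =
      (if (k, l) \<in> S then g (k, l) else 0)" for g k l
  proof -
    have "Polynomial.coeff (Polynomial.coeff (\<Sum>x\<in>S. Polynomial.smult [:g x:] (b x)) k) l =
        (\<Sum>x\<in>S. if x = (k, l) then g x else 0)"
      by (simp add: coeff_sum coeff_b if_distrib[of "\<lambda>t. g _ * t"] cong: if_cong)
    then show ?thesis using fin by (simp add: sum.delta)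
  qed
  have inj: "inj_on b S"
    by (rule inj_onI) (metis coeff_b surj_pair zero_neq_one)
  have "V.dim (Pi2 n) = (n + 2) choose 2"
  proof (rule V.dim_unique[of "b ` S"])
    show "b ` S \<subseteq> Pi2 n" by (auto simp: Pi2_def coeff_b S_def split: if_splits)
    show "Pi2 n \<subseteq> V.span (b ` S)"
    proof
      fix p assume p: "p \<in> Pi2 n"
      have zero: "Polynomial.coeff (Polynomial.coeff p k) l = 0" if "\<not> k + l < Suc n" for k l
        using p that by (fastforce simp: Pi2_def)
      have "p = (\<Sum>x\<in>S. Polynomial.smult [:Polynomial.coeff (Polynomial.coeff p (fst x)) (snd x):] (b x))"
        using zero by (intro poly_eqI) (subst coeff_sum, auto simp: S_def)
      also have "\<dots> \<in> V.span (b ` S)"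
        by (intro V.span_sum V.span_scale V.span_base imageI)
      finally show "p \<in> V.span (b ` S)" .
    qed
    show "V.independent (b ` S)"
    proof (rule V.independent_if_scalars_zero)
      fix g q assume g: "(\<Sum>x\<in>b ` S. Polynomial.smult [:g x:] x) = 0" and "q \<in> b ` S"
      then obtain k l where kl: "(k, l) \<in> S" "q = b (k, l)" by auto
      have "(\<Sum>x\<in>S. Polynomial.smult [:g (b x):] (b x)) = 0"
        using g inj by (simp add: sum.reindex)
      then show "g q = 0" using coeff_sum[of "\<lambda>x. g (b x)" k l] kl by simp
    qed (use fin in simp)
    show "card (b ` S) = (n + 2) choose 2"
      using card_sum_less[of "Suc n"] card_image[OF inj] by (simp add: S_def)
  qed
  then show ?thesis by (simp add: dim_Pi2_def)
qed

section \<open>Phase on the unit circle\<close>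

text \<open>The map sends the unit disc into the half-plane left of 1/2: after clearing the positive
  denominator the claim is that the squared modulus of \<open>u\<close> is below 1.\<close>

lemma Re_divide_one_plus_less:
  fixes u :: complex
  assumes "cmod u < 1"
  shows "Re (u / (1 + u)) < 1 / 2"
proof -
  have 1: "1 + u \<noteq> 0" using assms by (metis add_eq_0_iff norm_minus_cancel norm_one order_less_irrefl)
  have "(cmod u)\<^sup>2 < 1" using assms by (simp add: abs_square_less_1)
  then have sq: "(Re u)\<^sup>2 + (Im u)\<^sup>2 < 1" by (simp add: cmod_power2)
  have pos: "(1 + Re u)\<^sup>2 + (Im u)\<^sup>2 > 0"
    using 1 by (metis complex_neq_0 one_complex.sel plus_complex.sel add_0)
  have "Re (u / (1 + u)) = (Re u * (1 + Re u) + Im u * Im u) / ((1 + Re u)\<^sup>2 + (Im u)\<^sup>2)"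
    by (simp add: Re_divide)
  also have "\<dots> < 1 / 2"
    using pos sq by (simp add: divide_less_eq power2_eq_square algebra_simps)
  finally show ?thesis .
qed

text \<open>A real-valued lift of the argument of \<open>t ^ (m + 2) * cnj q / q\<close> at
  \<open>t = cis \<theta>\<close>, where \<open>q = 1 + r * t ^ 3\<close>. For
  \<open>r = cnj (c - a) / c\<close> this is the pencil quotient up to a unimodular
  constant.\<close>

definition phase :: "nat \<Rightarrow> complex \<Rightarrow> real \<Rightarrow> real" where
  "phase m r \<theta> = (real m + 2) * \<theta> - 2 * Arg (1 + r * cis (3 * \<theta>))"

text \<open>The curve stays in the right half-plane, away from zero and the branch cut of
  \<open>Ln\<close>, so \<open>Arg\<close> has no jumps along it.\<close>

lemma one_plus_cis_nonzero:
  assumes "cmod r < 1"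
  shows "1 + r * cis t \<noteq> 0" "1 + r * cis t \<notin> \<real>\<^sub>\<le>\<^sub>0"
proof -
  have "\<bar>Re (r * cis t)\<bar> \<le> cmod (r * cis t)" by (rule abs_Re_le_cmod)
  also have "\<dots> < 1" using assms by (simp add: norm_mult)
  finally have "Re (1 + r * cis t) > 0" by simp
  then show "1 + r * cis t \<noteq> 0" "1 + r * cis t \<notin> \<real>\<^sub>\<le>\<^sub>0"
    by (auto simp: complex_nonpos_Reals_iff simp del: plus_complex.sel)
qed

lemma DERIV_phase:
  assumes "cmod r < 1"
  shows "(phase m r has_real_derivative
    real m + 2 - 6 * Re (r * cis (3 * \<theta>) / (1 + r * cis (3 * \<theta>)))) (at \<theta>)"
proof -
  let ?g = "\<lambda>s. Ln (1 + r * exp (3 * \<i> * s))"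
  have cis: "exp (3 * \<i> * of_real \<theta>) = cis (3 * \<theta>)" for \<theta>
    by (simp add: cis_conv_exp mult_ac)
  let ?u = "r * cis (3 * \<theta>)"
  let ?e = "r * exp (3 * \<i> * of_real \<theta>)"
  have "1 + ?e \<noteq> 0" "1 + ?e \<notin> \<real>\<^sub>\<le>\<^sub>0"
    using one_plus_cis_nonzero[OF assms, of "3 * \<theta>"] by (simp_all only: cis not_False_eq_True)
  then have "(?g has_field_derivative (3 * \<i> * ?e) / (1 + ?e)) (at (of_real \<theta>))"
    by (auto intro!: derivative_eq_intros simp: divide_inverse mult_ac)
  then have "(?g has_field_derivative (3 * \<i> * ?u) / (1 + ?u)) (at (of_real \<theta>))"
    by (simp only: cis)
  then have V: "((\<lambda>t. ?g (of_real t)) has_vector_derivative (3 * \<i> * ?u) / (1 + ?u)) (at \<theta>)"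
    by (rule has_vector_derivative_real_field)
  have "((\<lambda>t. Im (?g (of_real t))) has_vector_derivative Im ((3 * \<i> * ?u) / (1 + ?u))) (at \<theta>)"
    by (rule bounded_linear.has_vector_derivative[OF bounded_linear_Im V])
  moreover have "Im ((3 * \<i> * ?u) / (1 + ?u)) = 3 * Re (?u / (1 + ?u))"
  proof -
    have "(3 * \<i> * ?u) / (1 + ?u) = \<i> * (3 * (?u / (1 + ?u)))" by simp
    moreover have "Im (\<i> * (3 * w)) = 3 * Re w" for w by simp
    ultimately show ?thesis by (simp only:)
  qed
  moreover have "Im (?g (of_real t)) = Arg (1 + r * cis (3 * t))" for t
    using one_plus_cis_nonzero[OF assms, of "3 * t"] by (simp only: cis) (simp add: Arg_eq_Im_Ln)
  ultimately have "((\<lambda>t. Arg (1 + r * cis (3 * t))) has_real_derivative 3 * Re (?u / (1 + ?u))) (at \<theta>)"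
    by (simp add: has_real_derivative_iff_has_vector_derivative)
  from DERIV_diff[OF DERIV_cmult[OF DERIV_ident, of "real m + 2"] DERIV_cmult[OF this, of 2]]
  show ?thesis unfolding phase_def by simp
qed

text \<open>By \<open>Re_divide_one_plus_less\<close> the derivative exceeds
  \<open>m + 2 - 3\<close>, which is nonnegative for \<open>m \<ge> 1\<close>.\<close>

lemma strict_mono_phase:
  assumes "cmod r < 1" "m \<ge> 1"
  shows "strict_mono (phase m r)"
proof (rule strict_monoI)
  fix x y :: real assume "x < y"
  then show "phase m r x < phase m r y"
  proof (rule DERIV_pos_imp_increasing)
    fix t
    have "cmod (r * cis (3 * t)) < 1" using assms by (simp add: norm_mult)
    from Re_divide_one_plus_less[OF this] assms(2)
    have "real m + 2 - 6 * Re (r * cis (3 * t) / (1 + r * cis (3 * t))) > 0" by linarith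
    then show "\<exists>d. (phase m r has_real_derivative d) (at t) \<and> 0 < d"
      using DERIV_phase[OF assms(1)] by blast
  qed
qed

lemma surj_phase:
  assumes "cmod r < 1"
  shows "\<exists>\<theta>. phase m r \<theta> = y"
proof -
  have bd: "\<bar>phase m r \<theta> - (real m + 2) * \<theta>\<bar> \<le> 2 * pi" for \<theta>
    using Arg_bounded[of "1 + r * cis (3 * \<theta>)"] by (simp add: phase_def abs_le_iff)
  have m: "real m + 2 > 0" by simp
  let ?l = "(y - 2 * pi) / (real m + 2)" and ?u = "(y + 2 * pi) / (real m + 2)"
  have "phase m r ?l \<le> y" "y \<le> phase m r ?u" using bd[of ?l] bd[of ?u] m by (simp_all add: abs_le_iff)
  moreover have "?l \<le> ?u" using m by (intro divide_right_mono) auto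
  moreover have "continuous_on {?l..?u} (phase m r)"
    using DERIV_phase[OF assms] DERIV_isCont by (intro continuous_at_imp_continuous_on) blast
  ultimately show ?thesis using IVT'[of "phase m r" ?l y ?u] by blast
qed

text \<open>The winding number is \<open>m + 2\<close>, since \<open>cis (3 * \<theta>)\<close>
  returns to its value after a full turn.\<close>

lemma phase_add_2pi: "phase m r (\<theta> + 2 * pi) = phase m r \<theta> + 2 * pi * real (m + 2)"
proof -
  have "cis (3 * (\<theta> + 2 * pi)) = cis (3 * \<theta>) * cis (2 * pi * 3)"
    by (simp add: cis_mult algebra_simps)
  also have "cis (2 * pi * 3) = 1" using cis_multiple_2pi[of 3] by simp
  finally show ?thesis by (simp add: phase_def algebra_simps)
qed

lemma cis_phase:
  assumes "cmod r < 1"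
  shows "cis (phase m r \<theta>) * (1 + r * cis (3 * \<theta>)) = cis \<theta> ^ (m + 2) * cnj (1 + r * cis (3 * \<theta>))"
proof -
  define q where "q = 1 + r * cis (3 * \<theta>)"
  have "q \<noteq> 0" using one_plus_cis_nonzero[OF assms] by (simp add: q_def)
  then have q: "q = of_real (cmod q) * cis (Arg q)"
    by (metis cis_Arg complex_sgn_def divide_complex_def mult.commute nonzero_divide_eq_eq norm_eq_zero of_real_eq_0_iff scaleR_conv_of_real sgn_div_norm of_real_inverse)
  then have qc: "cnj q = of_real (cmod q) * cis (- Arg q)"
    by (metis cis_cnj complex_cnj_complex_of_real complex_cnj_mult)
  have ph: "phase m r \<theta> = (real m + 2) * \<theta> - 2 * Arg q" by (simp add: phase_def q_def)
  have "cis (phase m r \<theta>) * q = of_real (cmod q) * (cis (phase m r \<theta>) * cis (Arg q))"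
    by (subst q) simp
  also have "cis (phase m r \<theta>) * cis (Arg q) = cis (real (m + 2) * \<theta>) * cis (- Arg q)"
    by (simp add: cis_mult ph algebra_simps)
  also have "cis (real (m + 2) * \<theta>) = cis \<theta> ^ (m + 2)"
    by (simp only: Complex.DeMoivre)
  finally show ?thesis unfolding q_def[symmetric] qc by (simp only: mult_ac)
qed

section \<open>Triples of angles modulo full turns\<close>

lemma cis_eq_imp_eq:
  assumes "cis u = cis v" "\<bar>u - v\<bar> < 2 * pi"
  shows "u = v"
proof -
  obtain n :: int where n: "u = v + 2 * pi * n"
    using assms(1) sin_cos_eq_iff[of u v] by (auto simp: complex_eq_iff)
  then have "2 * pi * \<bar>real_of_int n\<bar> < 2 * pi * 1" using assms(2) by (simp add: abs_mult)
  then have "\<bar>real_of_int n\<bar> < 1" by (subst (asm) mult_less_cancel_left_pos) auto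
  then show ?thesis using n by simp
qed

text \<open>After translation by a multiple of \<open>2 * pi\<close> the first angles agree, and the
  other two lie in the open turn above, where only \<open>y\<close> and \<open>s\<close> represent
  admissible points; the order decides which is which.\<close>

lemma cis_triple_shift:
  assumes "x < y" "y < s" "s < x + 2 * pi" "x' < y'" "y' < s'" "s' < x' + 2 * pi"
    and "cis x' = cis x" "cis y' \<in> {cis x, cis y, cis s}" "cis s' \<in> {cis x, cis y, cis s}"
  obtains n :: int where "x' = x + 2 * pi * n" "y' = y + 2 * pi * n" "s' = s + 2 * pi * n"
proof -
  obtain n :: int where n: "x' = x + 2 * pi * n"
    using assms(7) sin_cos_eq_iff[of x' x] by (auto simp: complex_eq_iff)
  have *: "u = y + 2 * pi * n \<or> u = s + 2 * pi * n"
    if u: "cis u \<in> {cis x, cis y, cis s}" "x' < u" "u < x' + 2 * pi" for u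
  proof -
    define t where "t = u - 2 * pi * n"
    have "cis t = cis u"
      using sin_cos_eq_iff[of u t] by (auto simp: complex_eq_iff t_def)
    moreover have t: "x < t" "t < x + 2 * pi" using u n by (auto simp: t_def)
    moreover have "\<bar>t - x\<bar> < 2 * pi" "\<bar>t - y\<bar> < 2 * pi" "\<bar>t - s\<bar> < 2 * pi"
      using t assms(1-3) by linarith+
    ultimately have "t = x \<or> t = y \<or> t = s"
      using u(1) cis_eq_imp_eq by (metis insertE singletonD)
    then show ?thesis using t(1) by (auto simp: t_def)
  qed
  have "y' = y + 2 * pi * n" "s' = s + 2 * pi * n"
    using *[of y'] *[of s'] assms by auto
  then show ?thesis using n that by blast
qed

text \<open>Equal point sets make one triple a cyclic rotation of the other up to full turns.
  Rotation by \<open>k \<in> {0, 1, 2}\<close> places with \<open>n\<close> common turns changes the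
  sum by \<open>2 * pi * (3 * n + k)\<close>, which vanishes only for
  \<open>n = k = 0\<close>.\<close>

lemma cis_triple_unique:
  assumes "x < y" "y < s" "s < x + 2 * pi" "x' < y'" "y' < s'" "s' < x' + 2 * pi"
    and sum: "x + y + s = x' + y' + s'"
    and set: "{cis x, cis y, cis s} = {cis x', cis y', cis s'}"
  shows "x = x' \<and> y = y' \<and> s = s'"
proof -
  have per: "cis (t + 2 * pi) = cis t" for t by (simp add: complex_eq_iff)
  have absurd: False if "2 * pi * (3 * real_of_int n + real_of_int k) = 0" "k \<in> {1, 2}" for n k :: int
  proof -
    have "real_of_int (3 * n + k) = 0" using that(1) by simp
    then have "3 * n + k = 0" by linarith
    then show False using that(2) by auto presburger+
  qed
  have mem: "cis y' \<in> {cis x, cis y, cis s}" "cis s' \<in> {cis x, cis y, cis s}" using set by auto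
  have "cis x' \<in> {cis x, cis y, cis s}" using set by auto
  then consider "cis x' = cis x" | "cis x' = cis y" | "cis x' = cis s" by auto
  then show ?thesis
  proof cases
    case 1
    obtain n :: int where n: "x' = x + 2 * pi * n" "y' = y + 2 * pi * n" "s' = s + 2 * pi * n"
      by (rule cis_triple_shift[OF assms(1-6) 1 mem])
    then have "n = 0" using sum by simp
    then show ?thesis using n by simp
  next
    case 2
    \<comment> \<open>The rotated triple \<open>y, s, x + 2 * pi\<close> again increases within one
      turn.\<close>
    obtain n :: int where n: "x' = y + 2 * pi * n" "y' = s + 2 * pi * n" "s' = x + 2 * pi + 2 * pi * n"
      by (rule cis_triple_shift[of y s "x + 2 * pi" x' y' s']) (use assms 2 mem per in auto)
    then show ?thesis using sum absurd[of n 1] by (simp add: algebra_simps)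
  next
    case 3
    obtain n :: int where n: "x' = s + 2 * pi * n" "y' = x + 2 * pi + 2 * pi * n"
        "s' = y + 2 * pi + 2 * pi * n"
      by (rule cis_triple_shift[of s "x + 2 * pi" "y + 2 * pi" x' y' s']) (use assms 3 mem per in auto)
    then show ?thesis using sum absurd[of n 2] by (simp add: algebra_simps)
  qed
qed

text \<open>The preimages under the phase of \<open>u\<close>, \<open>u + 2 * pi * d\<close> and
  \<open>u + 2 * pi * e\<close> have a sum continuous in \<open>u\<close>; the intermediate value
  theorem makes it \<open>\<tau>\<close>.\<close>

lemma phase_triple_exists:
  fixes d e :: nat
  assumes r: "cmod r < 1" and "m \<ge> 1" "0 < d" "d < e" "e < m + 2"
  shows "\<exists>x y s. x < y \<and> y < s \<and> s < x + 2 * pi \<and> phase m r y = phase m r x + 2 * pi * d \<and>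
    phase m r s = phase m r x + 2 * pi * e \<and> x + y + s = \<tau>"
proof -
  have mono: "strict_mono (phase m r)" using strict_mono_phase assms by blast
  define G where "G = inv_into UNIV (phase m r)"
  have FG: "phase m r (G y) = y" for y
    unfolding G_def using surj_phase[OF r] by (metis surj_f_inv_f surj_def)
  have GF: "G (phase m r x) = x" for x
    unfolding G_def using strict_mono_imp_inj_on[OF mono] by simp
  have less: "G u < G v \<longleftrightarrow> u < v" for u v
    using strict_mono_less[OF mono, of "G u" "G v"] FG by simp
  then have le: "G u \<le> G v \<longleftrightarrow> u \<le> v" for u v by (meson not_le)
  have "range G = UNIV" using GF by (metis surj_def)
  then have "continuous_on UNIV G" by (intro continuous_onI_mono) (auto simp: le)
  then have cont: "continuous_on S (\<lambda>u. G (u + k))" for S k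
    by (intro continuous_on_compose2[of UNIV G S]) (auto intro!: continuous_intros)
  define T where "T = (\<lambda>u. G (u + 0) + G (u + 2 * pi * d) + G (u + 2 * pi * e))"
  \<comment> \<open>At \<open>hi\<close> all three preimages are at least \<open>\<tau> / 3\<close>,
    at \<open>lo\<close> all are at most \<open>\<tau> / 3\<close>.\<close>
  define hi lo where "hi = phase m r (\<tau> / 3)" and "lo = hi - 2 * pi * e"
  have lohi: "lo \<le> hi" by (simp add: lo_def)
  have "T lo \<le> G hi + G hi + G hi"
    unfolding T_def using assms by (intro add_mono) (simp_all add: le lo_def)
  moreover have "G hi + G hi + G hi \<le> T hi"
    unfolding T_def by (intro add_mono) (simp_all add: le)
  moreover have "G hi + G hi + G hi = \<tau>" by (simp add: hi_def GF)
  moreover have "continuous_on {lo..hi} T"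
    unfolding T_def by (intro continuous_on_add cont)
  ultimately obtain u where u: "T u = \<tau>" using IVT'[of T lo \<tau> hi] lohi by auto
  \<comment> \<open>A full turn raises the phase by \<open>2 * pi * (m + 2)\<close>, so
    \<open>e < m + 2\<close> keeps the angles within one turn.\<close>
  have "G (u + 2 * pi * e) < G u + 2 * pi"
  proof -
    have "phase m r (G u + 2 * pi) = u + 2 * pi * real (m + 2)" by (simp only: phase_add_2pi FG)
    moreover have "2 * pi * e < 2 * pi * real (m + 2)" using assms by simp
    ultimately show ?thesis using strict_mono_less[OF mono, of "G (u + 2 * pi * e)" "G u + 2 * pi"] FG
      by (simp del: of_nat_add)
  qed
  moreover have "G u < G (u + 2 * pi * d)" "G (u + 2 * pi * d) < G (u + 2 * pi * e)"
    using assms by (simp_all add: less)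
  ultimately show ?thesis
    using u by (intro exI[of _ "G u"] exI[of _ "G (u + 2 * pi * d)"] exI[of _ "G (u + 2 * pi * e)"])
      (simp add: FG T_def)
qed

section \<open>Left kernel and the pencil\<close>

lemma delete_col_left_kernel:
  assumes "\<And>j. j < dim_col B \<Longrightarrow> (\<Sum>i<dim_row B. v i * B $$ (i, j)) = 0" "l < dim_col B"
    and j: "j < dim_col B - 1"
  shows "(\<Sum>i<dim_row B. v i * delete_col B l $$ (i, j)) = (0::complex)"
proof -
  have "Suc j < dim_col B" using j by linarith
  then have ins: "insert_index l j < dim_col B" by (simp add: insert_index_def)
  have "delete_col B l $$ (i, j) = B $$ (i, insert_index l j)" if "i < dim_row B" for i
    using that j by (simp add: delete_col_def)
  then show ?thesis using assms(1)[OF ins] by simp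
qed

lemma det_zero_if_left_kernel:
  fixes M :: "complex mat"
  assumes M: "M \<in> carrier_mat m m" and "i0 < m" "v i0 \<noteq> 0"
    and ker: "\<And>j. j < m \<Longrightarrow> (\<Sum>i<m. v i * M $$ (i, j)) = 0"
  shows "Determinant.det M = 0"
proof -
  have MT: "transpose_mat M \<in> carrier_mat m m" using M by simp
  define u where "u = Matrix.vec m v"
  have u: "u \<in> carrier_vec m" by (simp add: u_def)
  have "transpose_mat M *\<^sub>v u = 0\<^sub>v m"
  proof (rule eq_vecI)
    fix j assume "j < dim_vec (0\<^sub>v m :: complex Matrix.vec)"
    then have j: "j < m" by simp
    have "(transpose_mat M *\<^sub>v u) $ j = (\<Sum>i = 0..<m. M $$ (i, j) * v i)"
      using M j by (simp add: scalar_prod_def u_def)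
    also have "\<dots> = (\<Sum>i<m. v i * M $$ (i, j))"
      by (simp add: atLeast0LessThan mult.commute)
    also have "\<dots> = 0" by (rule ker[OF j])
    finally show "(transpose_mat M *\<^sub>v u) $ j = 0\<^sub>v m $ j" using j by simp
  qed (use M in simp)
  moreover have "u \<noteq> 0\<^sub>v m"
  proof
    assume "u = 0\<^sub>v m"
    then have "u $ i0 = 0" using assms(2) by simp
    then show False using assms(2,3) by (simp add: u_def)
  qed
  ultimately have "Determinant.det (transpose_mat M) = 0"
    unfolding det_0_iff_vec_prod_zero[OF MT] using u by (intro exI[of _ u] conjI)
  then show ?thesis unfolding det_transpose[OF M] .
qed

text \<open>A linear relation between the rows survives the deletion of any column, so every minor
  vanishes.\<close>

lemma common_zero_if_left_kernel:
  assumes "i0 < m" "v i0 \<noteq> 0"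
    and ker: "\<And>j. j \<le> m \<Longrightarrow> (\<Sum>i<m. v i * A_mat a c m z w $$ (i, j)) = 0"
  shows "Q_poly a c m k z w = 0"
proof -
  have dim: "dim_row (A_mat a c m z w) = m" "dim_col (A_mat a c m z w) = m + 1"
    by (simp_all add: A_mat_def)
  define D where "D = delete_col (A_mat a c m z w) (m - k)"
  have D: "D \<in> carrier_mat m m"
    unfolding D_def delete_col_def dim by simp
  have "(\<Sum>i<m. v i * D $$ (i, j)) = 0" if "j < m" for j
    unfolding D_def
  proof (rule delete_col_left_kernel[of "A_mat a c m z w" v "m - k" j, unfolded dim])
    fix j' assume "j' < m + 1"
    then have "j' \<le> m" by linarith
    then show "(\<Sum>i<m. v i * A_mat a c m z w $$ (i, j')) = 0" by (rule ker)
  qed (use that in linarith)+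
  then have "Determinant.det D = 0"
    by (rule det_zero_if_left_kernel[of D m i0 v, OF D assms(1,2)])
  then show ?thesis unfolding Q_poly_def D_def .
qed

lemma sum_mult_A_mat:
  assumes "j \<le> m"
  shows "(\<Sum>i<m. v i * A_mat a c m z w $$ (i, j)) =
    (if j < m then v j * z else 0) + (if 1 \<le> j then v (j - 1) * w else 0) +
    (if 2 \<le> j then v (j - 2) * (if j = 2 then cnj a else cnj c) else 0) +
    (if j + 1 < m then v (j + 1) * (if j + 1 = m - 1 then a else c) else 0)"
proof -
  \<comment> \<open>\<open>x\<close> and \<open>y\<close> vanish for \<open>j < 1\<close> and
    \<open>j < 2\<close> respectively, where the truncated \<open>j - 1\<close> and
    \<open>j - 2\<close> would point to a wrong row.\<close>
  define x y where "x = (if 1 \<le> j then v (j - 1) * w else 0)"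
    and "y = (if 2 \<le> j then v (j - 2) * (if j = 2 then cnj a else cnj c) else 0)"
  define u where "u = v (j + 1) * (if j + 1 = m - 1 then a else c)"
  have hx: "(if i = j - 1 then x else 0) = (if j = i + 1 then x else 0)" for i
  proof (cases "1 \<le> j")
    case True
    then have "(i = j - 1) = (j = i + 1)" by presburger
    then show ?thesis by (simp only:)
  next
    case False
    then show ?thesis by (simp only: x_def if_False if_cancel)
  qed
  have hy: "(if i = j - 2 then y else 0) = (if j = i + 2 then y else 0)" for i
  proof (cases "2 \<le> j")
    case True
    then have "(i = j - 2) = (j = i + 2)" by presburger
    then show ?thesis by (simp only:)
  next
    case False
    then show ?thesis by (simp only: y_def if_False if_cancel)
  qed
  have "v i * A_mat a c m z w $$ (i, j) =
      (if i = j then v j * z else 0) + (if i = j - 1 then x else 0) +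
      (if i = j - 2 then y else 0) + (if i = j + 1 then u else 0)" if i: "i < m" for i
  proof -
    have A: "A_mat a c m z w $$ (i, j) = (if j = i then z else if j = i + 1 then w
      else if j = i + 2 then (if i = 0 then cnj a else cnj c)
      else if i = j + 1 then (if i = m - 1 then a else c) else 0)"
      using i assms by (simp add: A_mat_def)
    consider "j = i" | "j = i + 1" | "j = i + 2" | "i = j + 1"
      | "j \<noteq> i" "j \<noteq> i + 1" "j \<noteq> i + 2" "i \<noteq> j + 1" by blast
    then show ?thesis
      unfolding hx hy A by cases (simp_all add: x_def y_def u_def)
  qed
  then have "(\<Sum>i<m. v i * A_mat a c m z w $$ (i, j)) =
    (\<Sum>i<m. (if i = j then v j * z else 0) + (if i = j - 1 then x else 0) +
      (if i = j - 2 then y else 0) + (if i = j + 1 then u else 0))"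
    by (intro sum.cong) auto
  also have "\<dots> = (\<Sum>i<m. if i = j then v j * z else 0) + (\<Sum>i<m. if i = j - 1 then x else 0) +
      (\<Sum>i<m. if i = j - 2 then y else 0) + (\<Sum>i<m. if i = j + 1 then u else 0)"
    by (simp only: sum.distrib)
  also have "(\<Sum>i<m. if i = j then v j * z else 0) = (if j < m then v j * z else 0)"
    by simp
  also have "(\<Sum>i<m. if i = j - 1 then x else 0) = x"
  proof (cases "1 \<le> j")
    case True
    then have "j - 1 < m" using assms by linarith
    then show ?thesis by simp
  qed (simp add: x_def)
  also have "(\<Sum>i<m. if i = j - 2 then y else 0) = y"
  proof (cases "2 \<le> j")
    case True
    then have "j - 2 < m" using assms by linarith
    then show ?thesis by simp
  qed (simp add: y_def)
  also have "(\<Sum>i<m. if i = j + 1 then u else 0) = (if j + 1 < m then u else 0)"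
    by simp
  finally show ?thesis unfolding x_def y_def u_def .
qed

section \<open>The pencil and its cubic divisors\<close>

text \<open>Written as a sum of monomials because the exponents 3 and \<open>m - 1\<close> coincide
  for \<open>m = 4\<close>.\<close>

definition pencil :: "complex \<Rightarrow> complex \<Rightarrow> nat \<Rightarrow> complex \<Rightarrow> complex \<Rightarrow> complex poly" where
  "pencil a c m \<alpha> \<beta> = Polynomial.monom (\<alpha> * c) 0 + Polynomial.monom (\<alpha> * cnj (c - a)) 3 +
     Polynomial.monom (\<beta> * (c - a)) (m - 1) + Polynomial.monom (\<beta> * cnj c) (m + 2)"

lemma coeff_cubic_mult:
  "Polynomial.coeff ([:p0, p1, p2, p3:] * v) n = p0 * Polynomial.coeff v n +
    (if 1 \<le> n then p1 * Polynomial.coeff v (n - 1) else 0) +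
    (if 2 \<le> n then p2 * Polynomial.coeff v (n - 2) else 0) +
    (if 3 \<le> n then p3 * Polynomial.coeff v (n - 3) else 0)"
proof -
  consider "n = 0" | "n = 1" | "n = 2" | n' where "n = Suc (Suc (Suc n'))"
    by (metis One_nat_def Suc_1 not0_implies_Suc)
  then show ?thesis by cases (simp_all add: numeral_2_eq_2 coeff_pCons add_ac)
qed

text \<open>The extreme coefficients isolate \<open>\<alpha>\<close> and \<open>\<beta>\<close>. The
  coefficient at \<open>j + 1\<close> belongs to column \<open>j\<close> of \<open>A_mat\<close>; it
  can be nonzero only for columns 2 and \<open>m - 2\<close>, which hold the corner entries
  \<open>cnj a\<close> and \<open>a\<close>.\<close>

lemma coeff_pencil:
  assumes "m \<ge> 2"
  shows "Polynomial.coeff (pencil a c m \<alpha> \<beta>) 0 = \<alpha> * c"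
    and "Polynomial.coeff (pencil a c m \<alpha> \<beta>) (m + 2) = \<beta> * cnj c"
    and "j \<le> m \<Longrightarrow> Polynomial.coeff (pencil a c m \<alpha> \<beta>) (j + 1) =
      (if j = 2 then \<alpha> * cnj (c - a) else 0) + (if j + 1 = m - 1 then \<beta> * (c - a) else 0)"
proof -
  have 0: "(3 = (0::nat)) = False" "(m - 1 = 0) = False" "(m + 2 = 0) = False" using assms by auto
  show "Polynomial.coeff (pencil a c m \<alpha> \<beta>) 0 = \<alpha> * c"
    unfolding pencil_def coeff_add coeff_monom 0 by simp
  have top: "(0 = m + 2) = False" "(3 = m + 2) = False" "(m - 1 = m + 2) = False" using assms by auto
  show "Polynomial.coeff (pencil a c m \<alpha> \<beta>) (m + 2) = \<beta> * cnj c"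
    unfolding pencil_def coeff_add coeff_monom top by simp
  assume j: "j \<le> m"
  have mid: "(0 = j + 1) = False" "(3 = j + 1) = (j = 2)" "(m + 2 = j + 1) = False" using j by auto
  have flip: "(m - 1 = j + 1) = (j + 1 = m - 1)" by (rule eq_commute)
  show "Polynomial.coeff (pencil a c m \<alpha> \<beta>) (j + 1) =
      (if j = 2 then \<alpha> * cnj (c - a) else 0) + (if j + 1 = m - 1 then \<beta> * (c - a) else 0)"
    unfolding pencil_def coeff_add coeff_monom mid flip by simp
qed

text \<open>\<open>main\<close> is the column equation with \<open>c\<close> in place of the corner
  entries \<open>a\<close>; its right side is the error made at the two corners. Extending
  \<open>V\<close> by zero from \<open>m\<close> on accounts for the entries cut off at the
  border.\<close>

lemma left_kernel_of_recurrence: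
  fixes V :: "nat \<Rightarrow> complex"
  assumes m: "m \<ge> 2" and high: "\<And>i. i \<ge> m \<Longrightarrow> V i = 0" and j: "j \<le> m"
    and main: "c * V (j + 1) + z * V j + (if 1 \<le> j then w * V (j - 1) else 0) +
        (if 2 \<le> j then cnj c * V (j - 2) else 0) =
      (if j = 2 then V 0 * cnj (c - a) else 0) + (if j + 1 = m - 1 then V (m - 1) * (c - a) else 0)"
  shows "(\<Sum>i<m. V i * A_mat a c m z w $$ (i, j)) = 0"
proof -
  have t1: "(if j < m then V j * z else 0) = z * V j"
    using high[of j] by (cases "j < m") auto
  have t2: "(if 1 \<le> j then V (j - 1) * w else 0) = (if 1 \<le> j then w * V (j - 1) else 0)"
    by (simp only: mult.commute)
  have t3: "(if 2 \<le> j then V (j - 2) * (if j = 2 then cnj a else cnj c) else 0) =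
      (if 2 \<le> j then cnj c * V (j - 2) else 0) - (if j = 2 then V 0 * cnj (c - a) else 0)"
    by (cases "j = 2") (simp_all add: right_diff_distrib mult.commute)
  have t4: "(if j + 1 < m then V (j + 1) * (if j + 1 = m - 1 then a else c) else 0) =
      c * V (j + 1) - (if j + 1 = m - 1 then V (m - 1) * (c - a) else 0)"
  proof (cases "j + 1 < m")
    case True
    define P where "P = V (j + 1)"
    have "V (m - 1) = P" if "j + 1 = m - 1" by (simp only: P_def that)
    then show ?thesis
      unfolding P_def[symmetric] using True by (auto simp: right_diff_distrib mult.commute)
  next
    case False
    then have "V (j + 1) = 0" "(j + 1 = m - 1) = False" using high m by auto
    then show ?thesis using False by (simp only: mult_zero_left mult_zero_right if_False if_cancel diff_self)
  qed
  have comb: "q + x + (y - u) + (p - v) = 0" if "p + q + x + y = u + v" for p q x y u v :: complex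
  proof -
    have "q + x + (y - u) + (p - v) = (p + q + x + y) - (u + v)"
      by (simp only: diff_conv_add_uminus minus_add_distrib add_ac)
    then show ?thesis by (simp only: that diff_self)
  qed
  show ?thesis unfolding sum_mult_A_mat[OF j] t1 t2 t3 t4 by (rule comb[OF main])
qed

text \<open>Comparing coefficients at 0 and \<open>m + 2\<close> gives \<open>\<alpha> = V 0\<close>
  and \<open>\<beta> = V (m - 1)\<close>; the remaining ones are then exactly the column equations
  for the coefficient vector of \<open>v\<close>.\<close>

lemma common_zero_if_cubic_divides_pencil:
  fixes v :: "complex poly"
  assumes m: "m \<ge> 2" and "c \<noteq> 0" "v \<noteq> 0" "degree v < m" "k \<le> m"
    and eq: "[:c, z, w, cnj c:] * v = pencil a c m \<alpha> \<beta>"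
  shows "Q_poly a c m k z w = 0"
proof -
  define V where "V = Polynomial.coeff v"
  have high: "V i = 0" if "i \<ge> m" for i
    using that assms(4) coeff_eq_0[of v i] by (simp add: V_def)
  note coeff_eq = arg_cong[OF eq, of "\<lambda>p. Polynomial.coeff p _", unfolded coeff_cubic_mult, folded V_def]
  have "c * V 0 = \<alpha> * c"
    using coeff_eq[of 0] unfolding coeff_pencil(1)[OF m] by simp
  then have \<alpha>: "\<alpha> = V 0" using assms(2) by simp
  have le: "Suc 0 \<le> m" using m by linarith
  have top: "m + 2 - 1 = m + 1" "m + 2 - 2 = m" "m + 2 - 3 = m - 1" using m by auto
  have "cnj c * V (m - 1) = \<beta> * cnj c"
    using coeff_eq[of "m + 2"] high[of m] high[of "m + 1"] high[of "m + 2"]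
    unfolding coeff_pencil(2)[OF m] top by (simp add: le)
  then have \<beta>: "\<beta> = V (m - 1)" using assms(2) by simp
  have kernel: "(\<Sum>i<m. V i * A_mat a c m z w $$ (i, j)) = 0" if j: "j \<le> m" for j
  proof (rule left_kernel_of_recurrence[OF m high j])
    have idx: "j + 1 - 1 = j" "j + 1 - 2 = j - 1" "j + 1 - 3 = j - 2" by auto
    have conds: "(1 \<le> j + 1) = True" "(2 \<le> j + 1) = (1 \<le> j)" "(3 \<le> j + 1) = (2 \<le> j)" by auto
    show "c * V (j + 1) + z * V j + (if 1 \<le> j then w * V (j - 1) else 0) +
        (if 2 \<le> j then cnj c * V (j - 2) else 0) =
      (if j = 2 then V 0 * cnj (c - a) else 0) + (if j + 1 = m - 1 then V (m - 1) * (c - a) else 0)"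
      using coeff_eq[of "j + 1"]
      unfolding coeff_pencil(3)[OF m j] idx conds if_True \<alpha> \<beta> .
  qed
  obtain i0 where i0: "V i0 \<noteq> 0" using assms(3) by (auto simp: V_def poly_eq_iff)
  then have "i0 < m" using high[of i0] by (meson not_le)
  then show ?thesis
    by (rule common_zero_if_left_kernel[of i0 m V, OF _ i0 kernel])
qed

lemma three_roots_dvd:
  fixes R :: "'a::field poly"
  assumes "poly R t = 0" "poly R u = 0" "poly R v = 0" "t \<noteq> u" "t \<noteq> v" "u \<noteq> v"
  shows "[:-t, 1:] * [:-u, 1:] * [:-v, 1:] dvd R"
proof -
  obtain R1 where R1: "R = [:-t, 1:] * R1" using assms(1) by (auto simp: poly_eq_0_iff_dvd elim: dvdE)
  then have "poly R1 u = 0" "poly R1 v = 0" using assms by auto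
  then obtain R2 where R2: "R1 = [:-u, 1:] * R2" by (auto simp: poly_eq_0_iff_dvd elim: dvdE)
  then have "poly R2 v = 0" using \<open>poly R1 v = 0\<close> assms by auto
  then obtain R3 where "R2 = [:-v, 1:] * R3" by (auto simp: poly_eq_0_iff_dvd elim: dvdE)
  then show ?thesis unfolding R1 R2 by (simp only: mult.assoc[symmetric] dvd_triv_left)
qed

text \<open>For three unimodular numbers the second elementary symmetric function is the product
  times the conjugate of the sum. With product \<open>- c / cnj c\<close>, the monic cubic times
  \<open>cnj c\<close> therefore has the shape \<open>[:c, z, w, cnj c:]\<close> with
  \<open>w = cnj z\<close>.\<close>

lemma common_zero_if_pencil_roots:
  assumes "m \<ge> 2" "c \<noteq> 0" "\<beta> \<noteq> 0" "k \<le> m"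
    and roots: "poly (pencil a c m \<alpha> \<beta>) t = 0" "poly (pencil a c m \<alpha> \<beta>) u = 0" "poly (pencil a c m \<alpha> \<beta>) v = 0"
    and ne: "t \<noteq> u" "t \<noteq> v" "u \<noteq> v"
    and norm: "cmod t = 1" "cmod u = 1" "cmod v = 1"
    and prod: "t * u * v = - c / cnj c"
  shows "Q_poly a c m k (- c * cnj (t + u + v)) (- cnj c * (t + u + v)) = 0"
proof -
  let ?z = "- c * cnj (t + u + v)" and ?w = "- cnj c * (t + u + v)"
  let ?L = "[:-t, 1:] * [:-u, 1:] * [:-v, 1:]"
  have cn: "x * cnj x = 1" if "cmod x = 1" for x
    using that by (simp add: complex_norm_square[symmetric])
  have cube: "[:c, ?z, ?w, cnj c:] = Polynomial.smult (cnj c) ?L"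
  proof -
    have e3: "cnj c * (t * u * v) = - c" using prod assms(2) by simp
    have "t * u + t * v + u * v = t * u * (v * cnj v) + t * v * (u * cnj u) + u * v * (t * cnj t)"
      by (simp add: cn norm)
    also have "\<dots> = (t * u * v) * cnj (t + u + v)" by (simp add: algebra_simps)
    finally have "cnj c * (t * u + t * v + u * v) = cnj c * (t * u * v) * cnj (t + u + v)" by simp
    then have e2: "cnj c * (t * u + t * v + u * v) = ?z" unfolding e3 by simp
    have "Polynomial.smult (cnj c) ?L = [:- (cnj c * (t * u * v)), cnj c * (t * u + t * v + u * v), ?w, cnj c:]"
      by (simp add: algebra_simps)
    then show ?thesis unfolding e2 e3 by simp
  qed
  have "?L dvd pencil a c m \<alpha> \<beta>" by (rule three_roots_dvd) (fact roots ne)+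
  then have "[:c, ?z, ?w, cnj c:] dvd pencil a c m \<alpha> \<beta>"
    unfolding cube by (rule smult_dvd) (simp add: assms)
  then obtain q where q: "pencil a c m \<alpha> \<beta> = [:c, ?z, ?w, cnj c:] * q" by (elim dvdE)
  \<comment> \<open>\<open>\<beta> \<noteq> 0\<close> keeps the pencil member, and with it the
    quotient \<open>q\<close>, nonzero.\<close>
  have "Polynomial.coeff (pencil a c m \<alpha> \<beta>) (m + 2) \<noteq> 0"
    using assms by (simp add: pencil_def)
  then have "q \<noteq> 0" using q by auto
  have "degree (pencil a c m \<alpha> \<beta>) \<le> m + 2"
    using assms(1) by (intro degree_le) (auto simp: pencil_def)
  moreover have "degree (pencil a c m \<alpha> \<beta>) = 3 + degree q"
    unfolding q using \<open>q \<noteq> 0\<close> assms(2) by (subst degree_mult_eq) auto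
  ultimately have "degree q < m" by simp
  then show ?thesis
    using common_zero_if_cubic_divides_pencil[OF assms(1,2) \<open>q \<noteq> 0\<close> _ assms(4) q[symmetric]] by blast
qed

section \<open>Counting the zeros\<close>

lemma cis_mult_cnj: "cis t * cnj (cis t) = 1"
  by (simp add: complex_norm_square[symmetric])

text \<open>At \<open>t = cis \<theta>\<close>, with \<open>q = 1 + r * t ^ 3\<close>, the
  polynomial equals \<open>c * cnj c * (t ^ (m + 2) * cnj q - E * q)\<close>, which
  \<open>cis_phase\<close> makes zero. Angles of equal phase modulo \<open>2 * pi\<close> are thus
  roots of one pencil member.\<close>

lemma pencil_root_cis:
  assumes "m \<ge> 1" "c \<noteq> 0" and less: "cmod (c - a) < cmod c"
    and r: "r = cnj (c - a) / c" and E: "cis (phase m r \<theta>) = E"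
  shows "poly (pencil a c m (- cnj c * E) c) (cis \<theta>) = 0"
proof -
  define s where "s = cis (3 * \<theta>)"
  define q where "q = 1 + r * s"
  have norm_r: "cmod r < 1"
    unfolding r norm_divide complex_mod_cnj using less assms(2) by simp
  have ss: "s * cnj s = 1" unfolding s_def by (rule cis_mult_cnj)
  have cube: "cis \<theta> ^ 3 = s" by (simp add: Complex.DeMoivre s_def)
  define T where "T = cis \<theta> ^ (m - 1)"
  have "m + 2 = (m - 1) + 3" using assms(1) by linarith
  then have T: "cis \<theta> ^ (m + 2) = T * s" unfolding T_def cube[symmetric] by (metis power_add)
  have cr: "c * r = cnj (c - a)" using assms(2) by (simp add: r)
  have cq: "c + cnj (c - a) * s = c * q" unfolding cr[symmetric] q_def by (simp add: distrib_left)
  have "cnj c * cnj r = c - a" using arg_cong[OF cr, of cnj] by (simp only: complex_cnj_mult complex_cnj_cnj)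
  then have cnj_cq: "cnj c * cnj q = cnj c + (c - a) * cnj s"
    unfolding q_def by (simp add: distrib_left flip: mult.assoc)
  have cqc: "T * (c - a) + cnj c * (T * s) = cnj c * (T * s) * cnj q"
  proof -
    have "T * (c - a) + cnj c * (T * s) = T * (c - a) * (s * cnj s) + cnj c * (T * s)"
      by (simp add: ss)
    also have "\<dots> = T * s * (cnj c + (c - a) * cnj s)" by (simp add: algebra_simps)
    also have "\<dots> = cnj c * (T * s) * cnj q" unfolding cnj_cq[symmetric] by (simp only: mult_ac)
    finally show ?thesis .
  qed
  have Eq: "E * q = T * s * cnj q"
    using cis_phase[OF norm_r, of m \<theta>] E T by (simp add: q_def s_def)
  have "poly (pencil a c m (- cnj c * E) c) (cis \<theta>) =
      (- cnj c * E) * (c + cnj (c - a) * s) + c * (T * (c - a) + cnj c * (T * s))"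
    unfolding pencil_def poly_add poly_monom cube T T_def[symmetric] by (simp add: algebra_simps)
  also have "\<dots> = c * cnj c * (T * s * cnj q - E * q)"
    unfolding cq cqc by (simp add: algebra_simps)
  finally show ?thesis using Eq by simp
qed

lemma common_zero_of_angles:
  assumes m: "m \<ge> 2" and c: "c \<noteq> 0" and less: "cmod (c - a) < cmod c"
    and r: "r = cnj (c - a) / c"
    and angles: "x < y" "y < s" "s < x + 2 * pi"
    and phases: "cis (phase m r y) = cis (phase m r x)" "cis (phase m r s) = cis (phase m r x)"
    and sum: "x + y + s = Arg (- c / cnj c)"
    and z: "z = - c * cnj (cis x + cis y + cis s)"
  shows "(of_real (Re z), of_real (Im z)) \<in> common_zeros a c m"
proof -
  let ?E = "cis (phase m r x)"
  have "poly (pencil a c m (- cnj c * ?E) c) (cis t) = 0" if "t \<in> {x, y, s}" for t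
    using that phases m by (intro pencil_root_cis[OF _ c less r]) auto
  then have roots: "poly (pencil a c m (- cnj c * ?E) c) (cis x) = 0"
    "poly (pencil a c m (- cnj c * ?E) c) (cis y) = 0"
    "poly (pencil a c m (- cnj c * ?E) c) (cis s) = 0" by blast+
  have "x \<noteq> y" "x \<noteq> s" "y \<noteq> s" "\<bar>x - y\<bar> < 2 * pi" "\<bar>x - s\<bar> < 2 * pi" "\<bar>y - s\<bar> < 2 * pi"
    using angles by linarith+
  then have ne: "cis x \<noteq> cis y" "cis x \<noteq> cis s" "cis y \<noteq> cis s"
    using cis_eq_imp_eq by metis+
  have "cis (Arg (- c / cnj c)) = - c / cnj c"
    using c by (simp add: cis_Arg sgn_eq norm_divide)
  then have prod: "cis x * cis y * cis s = - c / cnj c"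
    using sum by (simp add: cis_mult)
  have "Q_poly a c m k z (cnj z) = 0" if "k \<le> m" for k
    using common_zero_if_pencil_roots[OF m c c that roots ne _ _ _ prod] by (simp add: z)
  moreover have "of_real (Re z) + \<i> * of_real (Im z) = z"
    "of_real (Re z) - \<i> * of_real (Im z) = cnj z"
    by (simp_all add: complex_eq_iff)
  ultimately show ?thesis by (simp add: common_zeros_def Q_xy_def)
qed

text \<open>The linear coefficient of the monic cubic is the product times the conjugate of the sum,
  so product and sum determine the cubic and its root set.\<close>

lemma unimodular_triple_determined:
  assumes norms: "cmod t = 1" "cmod u = 1" "cmod v = 1" "cmod t' = 1" "cmod u' = 1" "cmod v' = 1"
    and prod: "t * u * v = t' * u' * v'" and sum: "t + u + v = t' + u' + v'"
  shows "{t, u, v} = {t', u', v'}"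
proof -
  have char: "(X - t) * (X - u) * (X - v) =
      X ^ 3 - (t + u + v) * X ^ 2 + (t * u * v) * cnj (t + u + v) * X - t * u * v"
    if "cmod t = 1" "cmod u = 1" "cmod v = 1" for X t u v
  proof -
    have "t * cnj t = 1" "u * cnj u = 1" "v * cnj v = 1"
      using that by (simp_all add: complex_norm_square[symmetric])
    moreover have "(t * u * v) * (cnj t + cnj u + cnj v) =
        u * v * (t * cnj t) + t * v * (u * cnj u) + t * u * (v * cnj v)"
      by (simp add: algebra_simps)
    ultimately have "(t * u * v) * (cnj t + cnj u + cnj v) = u * v + t * v + t * u" by simp
    then show ?thesis unfolding complex_cnj_add by (simp add: algebra_simps power2_eq_square power3_eq_cube)
  qed
  have "(X - t) * (X - u) * (X - v) = (X - t') * (X - u') * (X - v')" for X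
    unfolding char[OF norms(1-3)] char[OF norms(4-6)] prod sum ..
  then have "X \<in> {t, u, v} \<longleftrightarrow> X \<in> {t', u', v'}" for X
    by (metis (no_types) eq_iff_diff_eq_0 insert_iff mult_eq_0_iff singletonD)
  then show ?thesis by blast
qed

text \<open>One zero for each pair of phase gaps. The value \<open>z\<close> gives the sum of the
  three points and the prescribed angle sum gives their product, so \<open>z\<close> determines the
  points, then the angles, then the gaps.\<close>

lemma many_real_common_zeros:
  assumes m: "m \<ge> 1" and c: "c \<noteq> 0" and less: "cmod (c - a) < cmod c"
  shows "\<exists>S \<subseteq> common_zeros a c m. card S = (m + 1) choose 2 \<and> (\<forall>p\<in>S. real_point p)"
proof (cases "m = 1")
  case True
  have "Q_poly a c 1 k 0 0 = 0" for k
    by (rule common_zero_if_left_kernel[of 0 1 "\<lambda>_. 1"]) (auto simp: A_mat_def le_Suc_eq)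
  then have "(0, 0) \<in> common_zeros a c m"
    using True by (simp add: common_zeros_def Q_xy_def)
  then show ?thesis using True by (intro exI[of _ "{(0, 0)}"]) (auto simp: real_point_def numeral_2_eq_2)
next
  case False
  then have m2: "m \<ge> 2" using m by linarith
  define r where "r = cnj (c - a) / c"
  have norm_r: "cmod r < 1"
    unfolding r_def norm_divide complex_mod_cnj using less c by simp
  define \<tau> where "\<tau> = Arg (- c / cnj c)"
  define I where "I = {(i, j). i + j < m}"
  \<comment> \<open>\<open>d = i + 1\<close> and \<open>e = i + j + 2\<close> run through all
    \<open>0 < d < e < m + 2\<close> as \<open>i + j < m\<close>.\<close>
  define K where "K = (\<lambda>(x, y, s) (i, j). x < y \<and> y < s \<and> s < x + 2 * pi \<and>
    phase m r y = phase m r x + 2 * pi * real (i + 1) \<and>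
    phase m r s = phase m r x + 2 * pi * real (i + j + 2) \<and> x + y + s = \<tau>)"
  have "\<exists>t. K t q" if q_in: "q \<in> I" for q
  proof -
    obtain i j where q: "q = (i, j)" "i + j < m" using q_in by (auto simp: I_def)
    have "0 < i + 1" "i + 1 < i + j + 2" "i + j + 2 < m + 2" using q by linarith+
    from phase_triple_exists[OF norm_r m this, of \<tau>] show ?thesis by (auto simp: K_def q)
  qed
  then obtain T where T: "\<And>q. q \<in> I \<Longrightarrow> K (T q) q" by metis
  define Z where "Z = (\<lambda>(x, y, s). - c * cnj (cis x + cis y + cis s))"
  define g where "g = (\<lambda>q. (complex_of_real (Re (Z (T q))), complex_of_real (Im (Z (T q)))))"
  have periodic: "cis (p + 2 * pi * real n) = cis p" for p n
    using cis_multiple_2pi[of "real n"] by (simp flip: cis_mult)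
  have "g q \<in> common_zeros a c m" if q: "q \<in> I" for q
  proof -
    obtain x y s where xys: "T q = (x, y, s)" by (cases "T q")
    have "K (x, y, s) q" using T[OF q] xys by simp
    then have angles: "x < y" "y < s" "s < x + 2 * pi" "x + y + s = Arg (- c / cnj c)"
      and "\<exists>d::nat. phase m r y = phase m r x + 2 * pi * real d"
      and "\<exists>d::nat. phase m r s = phase m r x + 2 * pi * real d"
      unfolding K_def \<tau>_def by (cases q; blast)+
    then have phases: "cis (phase m r y) = cis (phase m r x)" "cis (phase m r s) = cis (phase m r x)"
      using periodic by metis+
    show ?thesis
      unfolding g_def xys
      by (rule common_zero_of_angles[OF m2 c less r_def angles(1-3) phases angles(4)])
        (simp add: Z_def)
  qed
  moreover have "inj_on g I"
  proof (rule inj_onI)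
    fix p q assume pq: "p \<in> I" "q \<in> I" "g p = g q"
    obtain x y s where p: "T p = (x, y, s)" by (cases "T p")
    obtain x' y' s' where q: "T q = (x', y', s')" by (cases "T q")
    obtain i j i' j' where ij: "p = (i, j)" "q = (i', j')" by (cases p, cases q)
    have Kp: "K (x, y, s) (i, j)" using T[OF pq(1)] p ij by simp
    have Kq: "K (x', y', s') (i', j')" using T[OF pq(2)] q ij by simp
    have "Z (x, y, s) = Z (x', y', s')" using pq(3) by (simp add: g_def p q complex_eq_iff)
    then have "cnj (cis x + cis y + cis s) = cnj (cis x' + cis y' + cis s')"
      using c unfolding Z_def by simp
    then have sum: "cis x + cis y + cis s = cis x' + cis y' + cis s'"
      by (simp only: complex_cnj_cancel_iff)
    have angle_sum: "x + y + s = x' + y' + s'" using Kp Kq by (simp add: K_def)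
    then have prod: "cis x * cis y * cis s = cis x' * cis y' * cis s'" by (simp add: cis_mult)
    have "{cis x, cis y, cis s} = {cis x', cis y', cis s'}"
      by (rule unimodular_triple_determined[OF _ _ _ _ _ _ prod sum]) simp_all
    \<comment> \<open>The angle sums agree exactly, not only modulo \<open>2 * pi\<close>, so the
      points determine the angles.\<close>
    then have eq: "x = x' \<and> y = y' \<and> s = s'"
      using Kp Kq angle_sum by (intro cis_triple_unique) (auto simp: K_def)
    then have "2 * pi * real (i + 1) = 2 * pi * real (i' + 1)"
      "2 * pi * real (i + j + 2) = 2 * pi * real (i' + j' + 2)"
      using Kp Kq by (auto simp: K_def)
    then show "p = q" using ij by simp
  qed
  then have "card (g ` I) = (m + 1) choose 2"
    unfolding I_def card_sum_less[symmetric] by (rule card_image)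
  moreover have "real_point (g q)" for q by (simp add: real_point_def g_def)
  ultimately show ?thesis by (intro exI[of _ "g ` I"]) auto
qed

theorem theorem4p3:
  fixes a c :: complex and m :: nat
  assumes "a \<noteq> 0" and "c \<noteq> 0"
    and "c * (c - a) \<in> \<real>"
    and "cmod c \<ge> 2 * cmod (c - a)"
    and "m \<ge> 1"
  shows "dim_Pi2 (m - 1) = (m + 1) choose 2 \<and>
    card (common_zeros a c m) = dim_Pi2 (m - 1) \<and>
    (\<forall>p \<in> common_zeros a c m. real_point p \<and> simple_zero a c m p)"
proof -
  have dim: "dim_Pi2 (m - 1) = (m + 1) choose 2"
    using dim_Pi2_eq[of "m - 1"] assms(5) by simp
  \<comment> \<open>Strictness comes from the factor 2 when \<open>c \<noteq> a\<close> and from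
    \<open>c \<noteq> 0\<close> otherwise.\<close>
  have less: "cmod (c - a) < cmod c"
  proof (cases "c = a")
    case False
    then have "0 < cmod (c - a)" by simp
    then show ?thesis using assms(4) by linarith
  qed (use assms(2) in simp)
  obtain S where S: "S \<subseteq> common_zeros a c m" "card S = (m + 1) choose 2" "\<forall>p\<in>S. real_point p"
    using many_real_common_zeros[OF assms(5,2) less] by blast
  note upper = card_common_zeros_le[OF assms(5), of a c]
  \<comment> \<open>The real zeros found already reach the upper bound, so there are no
    others.\<close>
  have S_eq: "S = common_zeros a c m"
    using S upper by (intro card_seteq) auto
  then have "card (common_zeros a c m) = (m + 1) choose 2" using S(2) by simp
  then show ?thesis
    using dim S(3) S_eq simple_zero_if_card_common_zeros[OF assms(5)] by metis
qed

end
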